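(* Let $\mathbb{F}$ be an algebraically closed field with $\mathrm{Char}(\mathbb{F})\neq 2$ and let $d\ge 3$. Let $A,A^*$ be a Leonard pair over $\mathbb{F}$ with diameter $d$ that has Krawtchouk type. Let $(\{\theta_i\}_{i=0}^d;\{\theta^*_i\}_{i=0}^d;\{\varphi_i\}_{i=1}^d;\{\phi_i\}_{i=1}^d)$ be a parameter array of $A,A^*$ with corresponding primary data $(\delta,\mu,h,\delta^*,\mu^*,h^*,\tau)$. Choose $\mu'\in\mathbb{F}$ with $\mu'^2=\mu^2-4\tau^2/\mu^{*2}$, and define $$\theta'_i=\mu'(i-d/2)\ (0\le i\le d),\qquad \varphi'_i=-\mu'\mu^*i(d-i+1)/2,\qquad \phi'_i=\mu'\mu^*i(d-i+1)/2\ (1\le i\le d).$$ Then the Leonard pair $A,A^*$ is near-bipartite, and the bipartite contraction of $A,A^*$ has Krawtchouk type with parameter array $(\{\theta'_i\}_{i=0}^d;\{\theta^*_i\}_{i=0}^d;\{\varphi'_i\}_{i=1}^d;\{\phi'_i\}_{i=1}^d)$.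
   Context: A tridiagonal matrix is irreducible if all its subdiagonal and superdiagonal entries are nonzero. Let $V$ be a vector space over $\mathbb{F}$ of dimension $d+1$. A Leonard pair on $V$ (with diameter $d$, over $\mathbb{F}$) is an ordered pair $A,A^*$ in $\mathrm{End}(V)$ such that (a) some basis of $V$ makes the matrix of $A$ irreducible tridiagonal and that of $A^*$ diagonal; (b) some basis of $V$ makes the matrix of $A^*$ irreducible tridiagonal and that of $A$ diagonal. ($A^*$ is just a name, not an adjoint.) Each of $A,A^*$ then has $d+1$ distinct eigenvalues. Flat part: let $E^*_0,\dots,E^*_d$ be the primitive idempotents of $A^*$ (projections onto its eigenspaces along the sum of the other eigenspaces). The flat part of $A$ is $F=\sum_{i=0}^d E^*_i A E^*_i$. $A,A^*$ is near-bipartite if $A-F,A^*$ is a Leonard pair on $V$; in that case $A-F,A^*$ is called the bipartite contraction of $A,A^*$. Parameter array: an ordering $\{\theta_i\}_{i=0}^d$ of the eigenvalues of $A$ is standard if in some basis $A$ is $\mathrm{diag}(\theta_0,\dots,\theta_d)$ and $A^*$ is irreducible tridiagonal; a standard ordering $\{\theta^*_i\}_{i=0}^d$ of the eigenvalues of $A^*$ is defined with the roles of $A$ and $A^*$ exchanged. Given standard orderings, there are unique scalars $\{\varphi_i\}_{i=1}^d$ such that in some basis $A$ is lower bidiagonal with diagonal $\theta_0,\dots,\theta_d$ and all subdiagonal entries $1$, while $A^*$ is upper bidiagonal with diagonal $\theta^*_0,\dots,\theta^*_d$ and superdiagonal $\varphi_1,\dots,\varphi_d$; and unique scalars $\{\phi_i\}_{i=1}^d$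 such that in some basis $A$ is lower bidiagonal with diagonal $\theta_d,\theta_{d-1},\dots,\theta_0$ and all subdiagonal entries $1$, while $A^*$ is upper bidiagonal with diagonal $\theta^*_0,\dots,\theta^*_d$ and superdiagonal $\phi_1,\dots,\phi_d$. The sequence $(\{\theta_i\};\{\theta^*_i\};\{\varphi_i\};\{\phi_i\})$ is a parameter array of $A,A^*$. Type II: for $d\ge 3$ it is known that $\frac{\theta_{i-2}-\theta_{i+1}}{\theta_{i-1}-\theta_i}$ and $\frac{\theta^*_{i-2}-\theta^*_{i+1}}{\theta^*_{i-1}-\theta^*_i}$ are equal and independent of $i$ for $2\le i\le d-1$; their common value is written $\beta+1$. $A,A^*$ has type II if $\beta=2$. It is known that a parameter array of type II has the form $\theta_i=\delta+\mu(i-d/2)+hi(d-i)$, $\theta^*_i=\delta^*+\mu^*(i-d/2)+h^*i(d-i)$ $(0\le i\le d)$, $\varphi_i=i(d-i+1)\big(\tau-\mu\mu^*/2+(h\mu^*+\mu h^* )(i-(d+1)/2)+hh^*(i-1)(d-i)\big)$, $\phi_i=i(d-i+1)\big(\tau+\mu\mu^*/2+(h\mu^*-\mu h^* )(i-(d+1)/2)+hh^*(i-1)(d-i)\big)$ $(1\le i\le d)$ for a unique sequence $(\delta,\mu,h,\delta^*,\mu^*,h^*,\tau)$ of scalars in $\mathbb{F}$, called the corresponding primary data. $A,A^*$ has Krawtchouk type if it has type II and both $\theta_i-\theta_{i-1}$ and $\theta^*_i-\theta^*_{i-1}$ are independent of $i$ for $1\le i\le d$. In that case $h=h^*=0$ and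 $\mu,\mu^*\ne0$. *)

theory Defs
  imports Main "HOL-Computational_Algebra.Polynomial" "Jordan_Normal_Form.Matrix"
begin

text \<open>The second member \<open>A\<^sup>*\<close> of a Leonard pair is written \<open>As\<close>, and similarly \<open>\<theta>s\<close>, \<open>\<mu>s\<close>, ...
  for the starred scalars.  The diameter is \<open>d\<close>.  Bases and scalar sequences are functions on
  \<open>nat\<close> of which only the indices \<open>0..d\<close> (or \<open>1..d\<close>) matter; matrices have rows and columns
  indexed by \<open>0..d\<close>.\<close>

definition irreducible_tridiagonal :: "'a::zero mat \<Rightarrow> bool" where
  "irreducible_tridiagonal M \<longleftrightarrow> square_mat M \<and>
     (\<forall>i<dim_row M. \<forall>j<dim_col M.
        (i + 1 < j \<or> j + 1 < i \<longrightarrow> M $$ (i, j) = 0) \<and>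
        (j = i + 1 \<or> i = j + 1 \<longrightarrow> M $$ (i, j) \<noteq> 0))"

definition lower_bidiagonal :: "nat \<Rightarrow> (nat \<Rightarrow> 'a::zero_neq_one) \<Rightarrow> 'a mat" where
  "lower_bidiagonal d f =
     mat (d + 1) (d + 1) (\<lambda>(i, j). if i = j then f i else if i = j + 1 then 1 else 0)"

text \<open>The superdiagonal scalars are numbered \<open>1..d\<close>; the entry in row \<open>i - 1\<close>, column \<open>i\<close> is
  \<open>g i\<close>.\<close>

definition upper_bidiagonal :: "nat \<Rightarrow> (nat \<Rightarrow> 'a::zero) \<Rightarrow> (nat \<Rightarrow> 'a) \<Rightarrow> 'a mat" where
  "upper_bidiagonal d f g =
     mat (d + 1) (d + 1) (\<lambda>(i, j). if i = j then f i else if j = i + 1 then g j else 0)"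

text \<open>No content beyond \<open>vector_space\<close>: a separate locale keeps the definitions below out of the
  interpretations of \<open>vector_space\<close> in the libraries.\<close>

locale leonard_space = vector_space scale
  for scale :: "'a::field \<Rightarrow> 'b::ab_group_add \<Rightarrow> 'b"
begin

definition ordered_basis :: "nat \<Rightarrow> (nat \<Rightarrow> 'b) \<Rightarrow> bool" where
  "ordered_basis d b \<longleftrightarrow>
     inj_on b {..d} \<and> independent (b ` {..d}) \<and> span (b ` {..d}) = UNIV"

text \<open>Column \<open>j\<close> of the matrix holds the coordinates of the image of \<open>b j\<close>.\<close>

definition matrix_of :: "nat \<Rightarrow> (nat \<Rightarrow> 'b) \<Rightarrow> ('b \<Rightarrow> 'b) \<Rightarrow> 'a mat" where
  "matrix_of d b T =
     mat (d + 1) (d + 1) (\<lambda>(i, j). representation (b ` {..d}) (T (b j)) (b i))"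

definition leonard_pair :: "nat \<Rightarrow> ('b \<Rightarrow> 'b) \<Rightarrow> ('b \<Rightarrow> 'b) \<Rightarrow> bool" where
  "leonard_pair d A As \<longleftrightarrow>
     dim UNIV = d + 1 \<and>
     Vector_Spaces.linear scale scale A \<and> Vector_Spaces.linear scale scale As \<and>
     (\<exists>b. ordered_basis d b \<and>
        irreducible_tridiagonal (matrix_of d b A) \<and> diagonal_mat (matrix_of d b As)) \<and>
     (\<exists>b. ordered_basis d b \<and>
        irreducible_tridiagonal (matrix_of d b As) \<and> diagonal_mat (matrix_of d b A))"

definition eigenspace :: "('b \<Rightarrow> 'b) \<Rightarrow> 'a \<Rightarrow> 'b set" where
  "eigenspace T x = {v. T v = scale x v}"

definition eigenvalues :: "('b \<Rightarrow> 'b) \<Rightarrow> 'a set" where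
  "eigenvalues T = {x. eigenspace T x \<noteq> {0}}"

definition is_projection :: "('b \<Rightarrow> 'b) \<Rightarrow> 'b set \<Rightarrow> 'b set \<Rightarrow> bool" where
  "is_projection E U W \<longleftrightarrow>
     Vector_Spaces.linear scale scale E \<and> E \<circ> E = E \<and> range E = U \<and> {v. E v = 0} = W"

text \<open>Meaningful when \<open>T\<close> is diagonalizable and \<open>x\<close> is one of its eigenvalues, so that the
  space is the direct sum of the eigenspaces and the projection exists and is unique.\<close>

definition primitive_idempotent :: "('b \<Rightarrow> 'b) \<Rightarrow> 'a \<Rightarrow> 'b \<Rightarrow> 'b" where
  "primitive_idempotent T x =
     (THE E. is_projection E (eigenspace T x)
               (span (\<Union>y\<in>eigenvalues T - {x}. eigenspace T y)))"

text \<open>The sum over \<open>i = 0..d\<close> is written as a sum over the eigenvalues of \<open>As\<close>, which are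
  finitely many and label the idempotents.\<close>

definition flat_part :: "('b \<Rightarrow> 'b) \<Rightarrow> ('b \<Rightarrow> 'b) \<Rightarrow> 'b \<Rightarrow> 'b" where
  "flat_part A As v =
     (\<Sum>x\<in>eigenvalues As. primitive_idempotent As x (A (primitive_idempotent As x v)))"

text \<open>The first member \<open>A - F\<close> of the bipartite contraction; the second member is \<open>As\<close>
  itself.\<close>

definition contraction :: "('b \<Rightarrow> 'b) \<Rightarrow> ('b \<Rightarrow> 'b) \<Rightarrow> 'b \<Rightarrow> 'b" where
  "contraction A As v = A v - flat_part A As v"

definition near_bipartite :: "nat \<Rightarrow> ('b \<Rightarrow> 'b) \<Rightarrow> ('b \<Rightarrow> 'b) \<Rightarrow> bool" where
  "near_bipartite d A As \<longleftrightarrow> leonard_pair d A As \<and> leonard_pair d (contraction A As) As"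

text \<open>A standard ordering of the eigenvalues of \<open>A\<close>; for the eigenvalues of \<open>As\<close> the two maps
  are exchanged.\<close>

definition standard_ordering :: "nat \<Rightarrow> ('b \<Rightarrow> 'b) \<Rightarrow> ('b \<Rightarrow> 'b) \<Rightarrow> (nat \<Rightarrow> 'a) \<Rightarrow> bool" where
  "standard_ordering d A As \<theta> \<longleftrightarrow>
     bij_betw \<theta> {..d} (eigenvalues A) \<and>
     (\<exists>b. ordered_basis d b \<and>
        matrix_of d b A = mat_diag (d + 1) \<theta> \<and> irreducible_tridiagonal (matrix_of d b As))"

text \<open>\<open>\<phi>1\<close> and \<open>\<phi>2\<close> are the first split sequence (usually written with a curly phi) and the second
  split sequence, which belongs to the reversed ordering of the eigenvalues of \<open>A\<close>.\<close>

definition parameter_array ::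
  "nat \<Rightarrow> ('b \<Rightarrow> 'b) \<Rightarrow> ('b \<Rightarrow> 'b) \<Rightarrow>
     (nat \<Rightarrow> 'a) \<Rightarrow> (nat \<Rightarrow> 'a) \<Rightarrow> (nat \<Rightarrow> 'a) \<Rightarrow> (nat \<Rightarrow> 'a) \<Rightarrow> bool" where
  "parameter_array d A As \<theta> \<theta>s \<phi>1 \<phi>2 \<longleftrightarrow>
     leonard_pair d A As \<and>
     standard_ordering d A As \<theta> \<and> standard_ordering d As A \<theta>s \<and>
     (\<exists>b. ordered_basis d b \<and>
        matrix_of d b A = lower_bidiagonal d \<theta> \<and>
        matrix_of d b As = upper_bidiagonal d \<theta>s \<phi>1) \<and>
     (\<exists>b. ordered_basis d b \<and>
        matrix_of d b A = lower_bidiagonal d (\<lambda>i. \<theta> (d - i)) \<and>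
        matrix_of d b As = upper_bidiagonal d \<theta>s \<phi>2)"

text \<open>\<open>\<beta> + 1\<close> is the common value of the two families of ratios.  A standard ordering is unique
  up to reversal, which does not change the ratios, so nothing depends on the orderings chosen;
  the same holds for the constancy condition in \<open>krawtchouk_type\<close>.\<close>

definition has_beta :: "nat \<Rightarrow> ('b \<Rightarrow> 'b) \<Rightarrow> ('b \<Rightarrow> 'b) \<Rightarrow> 'a \<Rightarrow> bool" where
  "has_beta d A As \<beta> \<longleftrightarrow>
     3 \<le> d \<and> leonard_pair d A As \<and>
     (\<exists>\<theta> \<theta>s. standard_ordering d A As \<theta> \<and> standard_ordering d As A \<theta>s \<and>
        (\<forall>i\<in>{2..d - 1}.
           (\<theta> (i - 2) - \<theta> (i + 1)) / (\<theta> (i - 1) - \<theta> i) = \<beta> + 1 \<and>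
           (\<theta>s (i - 2) - \<theta>s (i + 1)) / (\<theta>s (i - 1) - \<theta>s i) = \<beta> + 1))"

definition type_II :: "nat \<Rightarrow> ('b \<Rightarrow> 'b) \<Rightarrow> ('b \<Rightarrow> 'b) \<Rightarrow> bool" where
  "type_II d A As \<longleftrightarrow> has_beta d A As 2"

definition krawtchouk_type :: "nat \<Rightarrow> ('b \<Rightarrow> 'b) \<Rightarrow> ('b \<Rightarrow> 'b) \<Rightarrow> bool" where
  "krawtchouk_type d A As \<longleftrightarrow>
     type_II d A As \<and>
     (\<exists>\<theta> \<theta>s. standard_ordering d A As \<theta> \<and> standard_ordering d As A \<theta>s \<and>
        (\<exists>c. \<forall>i\<in>{1..d}. \<theta> i - \<theta> (i - 1) = c) \<and>
        (\<exists>c. \<forall>i\<in>{1..d}. \<theta>s i - \<theta>s (i - 1) = c))"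

end

definition primary_data ::
  "nat \<Rightarrow> (nat \<Rightarrow> 'a) \<Rightarrow> (nat \<Rightarrow> 'a) \<Rightarrow> (nat \<Rightarrow> 'a) \<Rightarrow> (nat \<Rightarrow> 'a) \<Rightarrow>
     'a \<Rightarrow> 'a \<Rightarrow> 'a \<Rightarrow> 'a \<Rightarrow> 'a \<Rightarrow> 'a \<Rightarrow> 'a::field \<Rightarrow> bool" where
  "primary_data d \<theta> \<theta>s \<phi>1 \<phi>2 \<delta> \<mu> h \<delta>s \<mu>s hs \<tau> \<longleftrightarrow>
     (\<forall>i\<le>d.
        \<theta> i = \<delta> + \<mu> * (of_nat i - of_nat d / 2) + h * of_nat i * (of_nat d - of_nat i) \<and>
        \<theta>s i = \<delta>s + \<mu>s * (of_nat i - of_nat d / 2) + hs * of_nat i * (of_nat d - of_nat i)) \<and>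
     (\<forall>i\<in>{1..d}.
        \<phi>1 i = of_nat i * (of_nat d - of_nat i + 1) *
          (\<tau> - \<mu> * \<mu>s / 2 + (h * \<mu>s + \<mu> * hs) * (of_nat i - (of_nat d + 1) / 2)
             + h * hs * (of_nat i - 1) * (of_nat d - of_nat i)) \<and>
        \<phi>2 i = of_nat i * (of_nat d - of_nat i + 1) *
          (\<tau> + \<mu> * \<mu>s / 2 + (h * \<mu>s - \<mu> * hs) * (of_nat i - (of_nat d + 1) / 2)
             + h * hs * (of_nat i - 1) * (of_nat d - of_nat i)))"

end

theory Submission
  imports Defs
begin

text \<open>Put \<open>K = As - \<delta>s\<close> and \<open>\<kappa> = 2 \<tau> / \<mu>s\<^sup>2\<close>.  A Krawtchouk pair generates a quotient of \<open>sl\<^sub>2\<close>, so on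
  the split basis \<open>a = A - \<delta>\<close> and \<open>K\<close> satisfy \<open>[K, [K, a]] = \<mu>s\<^sup>2 a - 2 \<tau> K\<close> and
  \<open>[a, [a, K]] = \<mu>\<^sup>2 K - 2 \<tau> a\<close>.  Since the diagonal of \<open>[K, [K, a]]\<close> vanishes on an eigenbasis
  of \<open>K\<close>, the flat part of \<open>A\<close> is \<open>\<delta> + \<kappa> K\<close>, and the contraction is \<open>B = a - \<kappa> K\<close>, which
  satisfies \<open>[B, [B, K]] = \<mu>'\<^sup>2 K\<close>.  Starting from an eigenvector of \<open>As\<close> for \<open>\<theta>s 0\<close> and
  applying \<open>B - \<theta>' 0\<close>, \<open>B - \<theta>' 1\<close>, ... in turn produces the first split basis of \<open>B, As\<close>; the
  second one arises from \<open>-\<mu>'\<close> in place of \<open>\<mu>'\<close>.  The two split bases together force \<open>As\<close> to be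
  irreducible tridiagonal on an eigenbasis of \<open>B\<close>.\<close>

section \<open>Symmetries of a finite path\<close>

text \<open>Consecutive values differ by exactly 1, and a change of direction would revisit
  \<open>\<sigma> i\<close> at \<open>i + 2\<close>. So \<open>\<sigma>\<close> is affine with slope
  1 or -1, and the bounds 0 and \<open>d\<close> fix \<open>\<sigma> 0\<close>.\<close>

lemma path_automorphism:
  fixes \<sigma> :: "nat \<Rightarrow> nat"
  assumes inj: "inj_on \<sigma> {..d}" and le: "\<And>i. i \<le> d \<Longrightarrow> \<sigma> i \<le> d"
    and adj: "\<And>i. i < d \<Longrightarrow> \<sigma> (i + 1) \<le> \<sigma> i + 1 \<and> \<sigma> i \<le> \<sigma> (i + 1) + 1"
  shows "(\<forall>i\<le>d. \<sigma> i = i) \<or> (\<forall>i\<le>d. \<sigma> i = d - i)"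
proof (cases "d = 0")
  case True
  then show ?thesis using le by auto
next
  case False
  define e where "e = int (\<sigma> 1) - int (\<sigma> 0)"
  have ne: "\<sigma> i \<noteq> \<sigma> j" if "i < j" "j \<le> d" for i j
    using that inj by (auto dest: inj_onD)
  have step: "int (\<sigma> (i + 1)) - int (\<sigma> i) = e \<and> (e = 1 \<or> e = -1)" if "i < d" for i
    using that
  proof (induction i)
    case 0
    then show ?case using adj[of 0] ne[of 0 1] by (auto simp: e_def)
  next
    case (Suc i)
    then have "int (\<sigma> (i + 1)) - int (\<sigma> i) = e" "e = 1 \<or> e = -1" by simp_all
    moreover have "\<sigma> (i + 2) \<le> \<sigma> (i + 1) + 1" "\<sigma> (i + 1) \<le> \<sigma> (i + 2) + 1"
      "\<sigma> (i + 1) \<noteq> \<sigma> (i + 2)" "\<sigma> i \<noteq> \<sigma> (i + 2)"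
      using Suc.prems adj[of "i + 1"] ne[of "i + 1" "i + 2"] ne[of i "i + 2"] by simp_all
    ultimately have "int (\<sigma> (i + 2)) - int (\<sigma> (i + 1)) = e" by linarith
    then show ?case using \<open>e = 1 \<or> e = -1\<close> by simp
  qed
  have lin: "int (\<sigma> i) = int (\<sigma> 0) + e * int i" if "i \<le> d" for i
    using that
  proof (induction i)
    case (Suc i)
    then show ?case using step[of i] by (auto simp: algebra_simps)
  qed simp
  have "e = 1 \<or> e = -1" using step[of 0] False by auto
  then show ?thesis
  proof
    assume e: "e = 1"
    then have "\<sigma> 0 = 0" using lin[of d] le[of d] by simp
    then have "\<sigma> i = i" if "i \<le> d" for i using lin[OF that] e by simp
    then show ?thesis by blast
  next
    assume e: "e = -1"
    then have "\<sigma> 0 = d" using lin[of d] le[of 0] by simp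
    then have "\<sigma> i = d - i" if "i \<le> d" for i using lin[OF that] e that by auto
    then show ?thesis by blast
  qed
qed

section \<open>Coordinates with respect to an ordered basis\<close>

context leonard_space
begin

notation scale (infixr "*s" 75)

abbreviation lin :: "('b \<Rightarrow> 'b) \<Rightarrow> bool" where
  "lin \<equiv> Vector_Spaces.linear scale scale"

lemma lin_iff: "lin T \<longleftrightarrow> (\<forall>x y. T (x + y) = T x + T y) \<and> (\<forall>c x. T (c *s x) = c *s T x)"
  by (simp add: linear_iff_module_hom module_hom_iff module_axioms)

lemma
  assumes "lin T"
  shows lin_add: "T (x + y) = T x + T y"
    and lin_scale: "T (c *s x) = c *s T x"
    and lin_diff: "T (x - y) = T x - T y"
    and lin_zero: "T 0 = 0"
    and lin_sum: "T (sum g I) = (\<Sum>i\<in>I. T (g i))"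
proof -
  interpret module_hom scale scale T
    using assms by (simp add: linear_iff_module_hom)
  show "T (x + y) = T x + T y" "T (c *s x) = c *s T x" "T (x - y) = T x - T y" "T 0 = 0"
    "T (sum g I) = (\<Sum>i\<in>I. T (g i))"
    by (simp_all add: add scale diff zero sum)
qed

definition coord :: "nat \<Rightarrow> (nat \<Rightarrow> 'b) \<Rightarrow> 'b \<Rightarrow> nat \<Rightarrow> 'a" where
  "coord d b x j = representation (b ` {..d}) x (b j)"

lemma coord_sum:
  assumes "ordered_basis d b"
  shows "(\<Sum>j\<le>d. coord d b x j *s b j) = x"
proof -
  have "x = (\<Sum>y\<in>b ` {..d}. representation (b ` {..d}) x y *s y)"
    using assms by (subst sum_representation_eq) (auto simp: ordered_basis_def)
  also have "\<dots> = (\<Sum>j\<le>d. coord d b x j *s b j)"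
    using assms by (subst sum.reindex) (auto simp: ordered_basis_def coord_def)
  finally show ?thesis by simp
qed

lemma
  assumes "ordered_basis d b"
  shows coord_add: "coord d b (x + y) j = coord d b x j + coord d b y j"
    and coord_scale: "coord d b (c *s x) j = c * coord d b x j"
    and coord_diff: "coord d b (x - y) j = coord d b x j - coord d b y j"
    and coord_zero: "coord d b 0 j = 0"
    and coord_sum_distrib: "coord d b (sum g I) j = (\<Sum>i\<in>I. coord d b (g i) j)"
  using assms unfolding coord_def ordered_basis_def
  by (simp_all add: representation_add representation_scale representation_diff
      representation_zero representation_sum)

lemma coord_basis:
  assumes "ordered_basis d b" "i \<le> d" "j \<le> d"
  shows "coord d b (b i) j = (if i = j then 1 else 0)"
  using assms unfolding coord_def ordered_basis_def
  by (auto simp: representation_basis inj_on_def)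

lemma coord_of_sum:
  assumes "ordered_basis d b" "j \<le> d"
  shows "coord d b (\<Sum>i\<le>d. c i *s b i) j = c j"
proof -
  have "coord d b (\<Sum>i\<le>d. c i *s b i) j = (\<Sum>i\<le>d. if i = j then c i else 0)"
    unfolding coord_sum_distrib[OF assms(1)] coord_scale[OF assms(1)]
    by (intro sum.cong) (use assms in \<open>auto simp: coord_basis\<close>)
  with assms show ?thesis by simp
qed

lemma coord_eqI:
  assumes "ordered_basis d b" "\<And>j. j \<le> d \<Longrightarrow> coord d b x j = coord d b y j"
  shows "x = y"
  using coord_sum[OF assms(1), of x] coord_sum[OF assms(1), of y] assms(2)
  by (metis (no_types, lifting) atMost_iff sum.cong)

lemma matrix_of_index:
  "i \<le> d \<Longrightarrow> j \<le> d \<Longrightarrow> matrix_of d b T $$ (i, j) = coord d b (T (b j)) i"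
  by (simp add: matrix_of_def coord_def)

lemma matrix_of_eq_iff:
  assumes "ordered_basis d b"
  shows "matrix_of d b T = mat (d + 1) (d + 1) f \<longleftrightarrow> (\<forall>j\<le>d. T (b j) = (\<Sum>i\<le>d. f (i, j) *s b i))"
proof
  assume *: "matrix_of d b T = mat (d + 1) (d + 1) f"
  show "\<forall>j\<le>d. T (b j) = (\<Sum>i\<le>d. f (i, j) *s b i)"
  proof (intro allI impI, rule coord_eqI[OF assms])
    fix j k assume "j \<le> d" "k \<le> d"
    then have "matrix_of d b T $$ (k, j) = f (k, j)" by (simp add: *)
    then show "coord d b (T (b j)) k = coord d b (\<Sum>i\<le>d. f (i, j) *s b i) k"
      using \<open>j \<le> d\<close> \<open>k \<le> d\<close> assms by (simp add: matrix_of_index coord_of_sum[where c = "\<lambda>i. f (i, j)"])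
  qed
next
  assume "\<forall>j\<le>d. T (b j) = (\<Sum>i\<le>d. f (i, j) *s b i)"
  then show "matrix_of d b T = mat (d + 1) (d + 1) f"
    using assms
    by (intro eq_matI)
      (simp_all add: less_Suc_eq_le matrix_of_index coord_of_sum[where c = "\<lambda>i. f (i, _)"],
       simp_all add: matrix_of_def)
qed

text \<open>The guards \<open>i = 0\<close> and \<open>j = d\<close> make up for the truncated index \<open>i - 1\<close> and for the
  arbitrary value of \<open>b (d + 1)\<close>.\<close>

lemma matrix_of_upper_bidiagonal:
  assumes "ordered_basis d b"
  shows "matrix_of d b T = upper_bidiagonal d f g \<longleftrightarrow>
    (\<forall>j\<le>d. T (b j) = f j *s b j + (if j = 0 then 0 else g j *s b (j - 1)))"
proof -
  have "(\<Sum>i\<le>d. (if i = j then f i else if j = i + 1 then g j else 0) *s b i) =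
      f j *s b j + (if j = 0 then 0 else g j *s b (j - 1))" if "j \<le> d" for j
  proof -
    have "(\<Sum>i\<le>d. (if i = j then f i else if j = i + 1 then g j else 0) *s b i) =
      (\<Sum>i\<le>d. (if i = j then f i *s b i else 0) + (if i = j - 1 then if j = 0 then 0 else g j *s b i else 0))"
      by (intro sum.cong) auto
    also have "\<dots> = f j *s b j + (if j = 0 then 0 else g j *s b (j - 1))"
    proof -
      have "j - 1 \<le> d" using that by simp
      with that show ?thesis by (simp add: sum.distrib)
    qed
    finally show ?thesis .
  qed
  note entries = this
  show ?thesis
    unfolding upper_bidiagonal_def matrix_of_eq_iff[OF assms] prod.case by (auto simp only: entries)
qed

lemma matrix_of_lower_bidiagonal:
  assumes "ordered_basis d b"
  shows "matrix_of d b T = lower_bidiagonal d f \<longleftrightarrow>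
    (\<forall>j\<le>d. T (b j) = f j *s b j + (if j = d then 0 else b (j + 1)))"
proof -
  have "(\<Sum>i\<le>d. (if i = j then f i else if i = j + 1 then 1 else 0) *s b i) =
      f j *s b j + (if j = d then 0 else b (j + 1))" if "j \<le> d" for j
  proof -
    have "(\<Sum>i\<le>d. (if i = j then f i else if i = j + 1 then 1 else 0) *s b i) =
      (\<Sum>i\<le>d. (if i = j then f i *s b i else 0) + (if i = j + 1 then b i else 0))"
      by (intro sum.cong) auto
    also have "\<dots> = f j *s b j + (if j = d then 0 else b (j + 1))"
      using that by (simp add: sum.distrib)
    finally show ?thesis .
  qed
  note entries = this
  show ?thesis
    unfolding lower_bidiagonal_def matrix_of_eq_iff[OF assms] prod.case by (auto simp only: entries)
qed

lemma matrix_of_diag: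
  assumes "ordered_basis d b"
  shows "matrix_of d b T = mat_diag (d + 1) f \<longleftrightarrow> (\<forall>j\<le>d. T (b j) = f j *s b j)"
proof -
  have "(\<Sum>i\<le>d. (if i = j then f j else 0) *s b i) = f j *s b j" if "j \<le> d" for j
  proof -
    have "(\<Sum>i\<le>d. (if i = j then f j else 0) *s b i) = (\<Sum>i\<le>d. if i = j then f i *s b i else 0)"
      by (intro sum.cong) auto
    with that show ?thesis by simp
  qed
  note entries = this
  show ?thesis
    unfolding mat_diag_def matrix_of_eq_iff[OF assms] prod.case by (auto simp only: entries)
qed

lemma irreducible_tridiagonal_matrix_of:
  "irreducible_tridiagonal (matrix_of d b T) \<longleftrightarrow> (\<forall>i\<le>d. \<forall>j\<le>d.
     (i + 1 < j \<or> j + 1 < i \<longrightarrow> coord d b (T (b j)) i = 0) \<and>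
     (j = i + 1 \<or> i = j + 1 \<longrightarrow> coord d b (T (b j)) i \<noteq> 0))"
proof -
  have "dim_row (matrix_of d b T) = d + 1" "dim_col (matrix_of d b T) = d + 1"
    by (simp_all add: matrix_of_def)
  then show ?thesis
    by (simp add: irreducible_tridiagonal_def matrix_of_index less_Suc_eq_le)
qed

section \<open>Triangular families and reversed bases\<close>

text \<open>In a vanishing combination, the largest index with nonzero coefficient is detected by
  its own coordinate, so the \<open>w i\<close> are independent. Being \<open>d + 1\<close> in
  number, they span.\<close>

lemma ordered_basis_triangular:
  assumes v: "ordered_basis d v"
    and upper: "\<And>i j. i < j \<Longrightarrow> j \<le> d \<Longrightarrow> coord d v (w i) j = 0"
    and diag: "\<And>i. i \<le> d \<Longrightarrow> coord d v (w i) i \<noteq> 0"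
  shows "ordered_basis d w"
proof -
  have indep: "\<forall>i\<le>d. c i = 0" if "(\<Sum>i\<le>d. c i *s w i) = 0" for c
  proof (rule ccontr)
    assume nz: "\<not> (\<forall>i\<le>d. c i = 0)"
    define m where "m = Max {i. i \<le> d \<and> c i \<noteq> 0}"
    have fin: "finite {i. i \<le> d \<and> c i \<noteq> 0}" and ne: "{i. i \<le> d \<and> c i \<noteq> 0} \<noteq> {}"
      using nz by auto
    have m: "m \<le> d" "c m \<noteq> 0" using Max_in[OF fin ne] by (simp_all add: m_def)
    have gt: "c i = 0" if "m < i" "i \<le> d" for i
      using Max_ge[OF fin, of i] that by (auto simp: m_def[symmetric])
    have "0 = coord d v (\<Sum>i\<le>d. c i *s w i) m" by (simp add: that coord_zero[OF v])
    also have "\<dots> = (\<Sum>i\<le>d. c i * coord d v (w i) m)"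
      by (simp add: coord_sum_distrib[OF v] coord_scale[OF v])
    also have "\<dots> = (\<Sum>i\<le>d. if i = m then c m * coord d v (w m) m else 0)"
    proof (intro sum.cong refl)
      fix i assume "i \<in> {..d}"
      then show "c i * coord d v (w i) m = (if i = m then c m * coord d v (w m) m else 0)"
        using gt[of i] upper[of i m] m by (cases i m rule: linorder_cases) simp_all
    qed
    also have "\<dots> = c m * coord d v (w m) m" using m by simp
    finally show False using m diag by simp
  qed
  have inj: "inj_on w {..d}"
  proof (rule inj_onI, rule ccontr)
    fix i j assume ij: "i \<in> {..d}" "j \<in> {..d}" "w i = w j" "i \<noteq> j"
    have "(\<Sum>k\<le>d. (if k = i then 1 else if k = j then -1 else 0) *s w k) =
      (\<Sum>k\<le>d. (if k = i then w k else 0) - (if k = j then w k else 0))"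
      using ij by (intro sum.cong) auto
    also have "\<dots> = 0" using ij by (simp add: sum_subtractf)
    finally show False using indep[of "\<lambda>k. if k = i then 1 else if k = j then -1 else 0"] ij by fastforce
  qed
  have ind: "independent (w ` {..d})"
  proof (rule independent_if_scalars_zero)
    fix f x assume "(\<Sum>x\<in>w ` {..d}. f x *s x) = 0" "x \<in> w ` {..d}"
    then show "f x = 0"
      using indep[of "f \<circ> w"] by (auto simp: sum.reindex[OF inj])
  qed simp
  interpret finite_dimensional_vector_space scale "v ` {..d}"
    by unfold_locales (use v in \<open>auto simp: ordered_basis_def\<close>)
  have "card (v ` {..d}) = dim UNIV"
    by (rule basis_card_eq_dim) (use v in \<open>auto simp: ordered_basis_def\<close>)
  then have "dim UNIV \<le> card (w ` {..d})"
    using v inj by (simp add: card_image ordered_basis_def)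
  then have "UNIV \<subseteq> span (w ` {..d})"
    by (intro card_ge_dim_independent) (use ind in auto)
  with inj ind show ?thesis by (auto simp: ordered_basis_def)
qed

lemma image_rev_atMost: "(\<lambda>i. b (d - i)) ` {..d} = b ` {..d}" for d :: nat
proof
  show "b ` {..d} \<subseteq> (\<lambda>i. b (d - i)) ` {..d}"
  proof
    fix x assume "x \<in> b ` {..d}"
    then obtain i where "i \<le> d" "x = b i" by auto
    then show "x \<in> (\<lambda>i. b (d - i)) ` {..d}" by (intro image_eqI[of _ _ "d - i"]) auto
  qed
qed auto

lemma ordered_basis_rev:
  assumes "ordered_basis d b"
  shows "ordered_basis d (\<lambda>i. b (d - i))"
proof -
  have "inj_on (\<lambda>i. b (d - i)) {..d}"
  proof (rule inj_onI)
    fix i j assume "i \<in> {..d}" "j \<in> {..d}" "b (d - i) = b (d - j)"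
    moreover from this have "d - i = d - j"
      using assms by (intro inj_onD[of b "{..d}"]) (auto simp: ordered_basis_def)
    ultimately show "i = j" by (simp add: eq_diff_iff)
  qed
  then show ?thesis using assms by (simp add: ordered_basis_def image_rev_atMost)
qed

text \<open>Reversal exchanges entries above and below the diagonal; later statements about the
  lower half are obtained this way.\<close>

lemma coord_rev: "coord d (\<lambda>i. b (d - i)) x i = coord d b x (d - i)"
  by (simp add: coord_def image_rev_atMost)

section \<open>Diagonal maps, standard orderings and the flat part\<close>

lemma coord_lin:
  assumes "ordered_basis d b" "lin T"
  shows "coord d b (T x) j = (\<Sum>i\<le>d. coord d b x i * coord d b (T (b i)) j)"
proof -
  have "coord d b (T x) j = coord d b (T (\<Sum>i\<le>d. coord d b x i *s b i)) j"
    by (simp only: coord_sum[OF assms(1)])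
  then show ?thesis
    by (simp add: lin_sum[OF assms(2)] lin_scale[OF assms(2)] coord_sum_distrib[OF assms(1)]
        coord_scale[OF assms(1)])
qed

lemma coord_diag:
  assumes "ordered_basis d b" "lin T" "\<And>i. i \<le> d \<Longrightarrow> T (b i) = t i *s b i" "j \<le> d"
  shows "coord d b (T x) j = t j * coord d b x j"
proof -
  have "coord d b (T x) j = (\<Sum>i\<le>d. if i = j then t j * coord d b x j else 0)"
    by (subst coord_lin[OF assms(1,2)], intro sum.cong)
      (use assms in \<open>auto simp: coord_scale coord_basis\<close>)
  with assms(4) show ?thesis by simp
qed

lemma eigen_coord_zero:
  assumes "ordered_basis d b" "lin T" "\<And>i. i \<le> d \<Longrightarrow> T (b i) = t i *s b i"
    and "T x = c *s x" "j \<le> d" "t j \<noteq> c"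
  shows "coord d b x j = 0"
  using coord_diag[OF assms(1,2,3,5), of x] assms by (simp add: coord_scale)

lemma ordered_basis_nonzero: "ordered_basis d b \<Longrightarrow> i \<le> d \<Longrightarrow> b i \<noteq> 0"
  using coord_basis[of d b i i] coord_zero[of d b i] by fastforce

lemma eigenvalues_diag:
  assumes "ordered_basis d b" "lin T" "\<And>i. i \<le> d \<Longrightarrow> T (b i) = t i *s b i"
  shows "eigenvalues T = t ` {..d}"
proof
  show "t ` {..d} \<subseteq> eigenvalues T"
    using assms ordered_basis_nonzero[OF assms(1)] by (auto simp: eigenvalues_def eigenspace_def)
  show "eigenvalues T \<subseteq> t ` {..d}"
  proof
    fix c assume "c \<in> eigenvalues T"
    then obtain x where x: "x \<noteq> 0" "T x = c *s x"
      using lin_zero[OF assms(2)] by (auto simp: eigenvalues_def eigenspace_def)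
    show "c \<in> t ` {..d}"
    proof (rule ccontr)
      assume "c \<notin> t ` {..d}"
      then have "coord d b x j = coord d b 0 j" if "j \<le> d" for j
        using eigen_coord_zero[OF assms x(2) that] that by (auto simp: coord_zero[OF assms(1)])
      then show False using coord_eqI[OF assms(1)] x(1) by blast
    qed
  qed
qed

text \<open>The eigenspaces of \<open>A\<close> are lines, so \<open>b2\<close> consists of
  multiples of the vectors of \<open>b\<close> in another order. Irreducibility of \<open>As\<close>
  on \<open>b2\<close> and the zeros of \<open>As\<close> on \<open>b\<close> make neighbours go to
  neighbours, so the permutation is a path symmetry.\<close>

lemma standard_ordering_unique:
  assumes "lin A" "lin As" "standard_ordering d A As t" "standard_ordering d A As t2"
  shows "(\<forall>i\<le>d. t2 i = t i) \<or> (\<forall>i\<le>d. t2 i = t (d - i))"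
proof -
  obtain b where b: "ordered_basis d b" "\<And>i. i \<le> d \<Longrightarrow> A (b i) = t i *s b i"
    and irr_b: "irreducible_tridiagonal (matrix_of d b As)"
    using assms(3) unfolding standard_ordering_def by (metis matrix_of_diag)
  have tri: "coord d b (As (b j)) i = 0" if "i \<le> d" "j \<le> d" "i + 1 < j \<or> j + 1 < i" for i j
    using irr_b that unfolding irreducible_tridiagonal_matrix_of by blast
  obtain b2 where b2: "ordered_basis d b2" "\<And>i. i \<le> d \<Longrightarrow> A (b2 i) = t2 i *s b2 i"
    and irr_b2: "irreducible_tridiagonal (matrix_of d b2 As)"
    using assms(4) unfolding standard_ordering_def by (metis matrix_of_diag)
  have irr: "coord d b2 (As (b2 i)) (i + 1) \<noteq> 0" if "i < d" for i
  proof -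
    have "i \<le> d" "i + 1 \<le> d" using that by simp_all
    then show ?thesis using irr_b2 unfolding irreducible_tridiagonal_matrix_of by blast
  qed
  have bij: "bij_betw t {..d} (eigenvalues A)" "bij_betw t2 {..d} (eigenvalues A)"
    using assms by (auto simp: standard_ordering_def)
  define \<sigma> where "\<sigma> i = inv_into {..d} t (t2 i)" for i
  have \<sigma>: "\<sigma> i \<le> d" "t (\<sigma> i) = t2 i" if "i \<le> d" for i
  proof -
    have "t2 i \<in> t ` {..d}" using that bij by (auto simp: bij_betw_def)
    then show "\<sigma> i \<le> d" "t (\<sigma> i) = t2 i"
      using inv_into_into[of "t2 i" t "{..d}"] f_inv_into_f[of "t2 i" t "{..d}"] by (auto simp: \<sigma>_def)
  qed
  have inj: "inj_on \<sigma> {..d}"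
  proof (rule inj_onI)
    fix i j assume "i \<in> {..d}" "j \<in> {..d}" "\<sigma> i = \<sigma> j"
    then have "t2 i = t2 j" using \<sigma>(2)[of i] \<sigma>(2)[of j] by simp
    then show "i = j" using bij(2) \<open>i \<in> {..d}\<close> \<open>j \<in> {..d}\<close> by (auto simp: bij_betw_def dest: inj_onD)
  qed
  define s where "s i = coord d b (b2 i) (\<sigma> i)" for i
  have b2_eq: "b2 i = s i *s b (\<sigma> i)" if i: "i \<le> d" for i
  proof (rule coord_eqI[OF b(1)])
    fix j assume j: "j \<le> d"
    show "coord d b (b2 i) j = coord d b (s i *s b (\<sigma> i)) j"
    proof (cases "j = \<sigma> i")
      case True
      then show ?thesis using b \<sigma>[OF i] by (simp add: coord_scale coord_basis s_def)
    next
      case False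
      then have "t j \<noteq> t2 i"
        using bij(1) j \<sigma>[OF i] by (metis atMost_iff bij_betw_imp_inj_on inj_onD)
      then have "coord d b (b2 i) j = 0"
        using eigen_coord_zero[OF b(1) assms(1) b(2) b2(2)[OF i] j] by simp
      then show ?thesis using b \<sigma>[OF i] j False by (simp add: coord_scale coord_basis)
    qed
  qed
  have s: "s i \<noteq> 0" if "i \<le> d" for i
    using b2_eq[OF that] ordered_basis_nonzero[OF b2(1) that] by auto
  have "\<sigma> (i + 1) \<le> \<sigma> i + 1 \<and> \<sigma> i \<le> \<sigma> (i + 1) + 1" if i: "i < d" for i
  proof (rule ccontr)
    assume "\<not> (\<sigma> (i + 1) \<le> \<sigma> i + 1 \<and> \<sigma> i \<le> \<sigma> (i + 1) + 1)"
    then have zero: "coord d b (As (b (\<sigma> i))) (\<sigma> (i + 1)) = 0"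
      using \<sigma>(1)[of i] \<sigma>(1)[of "i + 1"] i by (intro tri) auto
    \<comment> \<open>The same coefficient expanded through \<open>b2\<close> keeps only the term
      \<open>k = i + 1\<close>, because \<open>\<sigma>\<close> is injective, and that term is
      nonzero.\<close>
    have "s i * coord d b (As (b (\<sigma> i))) (\<sigma> (i + 1)) = coord d b (As (b2 i)) (\<sigma> (i + 1))"
      using i b by (simp add: b2_eq lin_scale[OF assms(2)] coord_scale)
    also have "\<dots> = coord d b (\<Sum>k\<le>d. coord d b2 (As (b2 i)) k *s b2 k) (\<sigma> (i + 1))"
      by (simp only: coord_sum[OF b2(1)])
    also have "\<dots> = (\<Sum>k\<le>d. coord d b2 (As (b2 i)) k * coord d b (b2 k) (\<sigma> (i + 1)))"
      by (simp only: coord_sum_distrib[OF b(1)] coord_scale[OF b(1)])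
    also have "\<dots> = (\<Sum>k\<le>d. if k = i + 1 then coord d b2 (As (b2 i)) (i + 1) * s (i + 1) else 0)"
    proof (intro sum.cong refl)
      fix k assume "k \<in> {..d}"
      moreover have "\<sigma> k \<noteq> \<sigma> (i + 1)" if "k \<noteq> i + 1"
        using inj that i \<open>k \<in> {..d}\<close> by (auto dest: inj_onD)
      ultimately show "coord d b2 (As (b2 i)) k * coord d b (b2 k) (\<sigma> (i + 1)) =
          (if k = i + 1 then coord d b2 (As (b2 i)) (i + 1) * s (i + 1) else 0)"
        using i b \<sigma> by (auto simp: b2_eq coord_scale coord_basis)
    qed
    also have "\<dots> = coord d b2 (As (b2 i)) (i + 1) * s (i + 1)" using i by simp
    finally show False using zero irr[OF i] s[of "i + 1"] i by simp
  qed
  then have "(\<forall>i\<le>d. \<sigma> i = i) \<or> (\<forall>i\<le>d. \<sigma> i = d - i)"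
    by (intro path_automorphism inj \<sigma>(1))
  then show ?thesis
  proof
    assume "\<forall>i\<le>d. \<sigma> i = i"
    then have "t2 i = t i" if "i \<le> d" for i
      using \<sigma>(2)[OF that] that by simp
    then show ?thesis by blast
  next
    assume "\<forall>i\<le>d. \<sigma> i = d - i"
    then have "t2 i = t (d - i)" if "i \<le> d" for i
      using \<sigma>(2)[OF that] that by simp
    then show ?thesis by blast
  qed
qed

section \<open>Primitive idempotents and the flat part\<close>

text \<open>\<open>E'\<close> fixes \<open>E x\<close>, which lies in the common range, and kills
  \<open>x - E x\<close>, which lies in the common kernel. This resolves the definite description in
  \<open>primitive_idempotent\<close>.\<close>

lemma is_projection_unique:
  assumes "is_projection E U W" "is_projection E' U W"
  shows "E = E'"
proof
  fix x
  have lin: "lin E" "lin E'" and idem: "\<And>x. E (E x) = E x" "\<And>x. E' (E' x) = E' x"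
    and U: "range E = range E'" and W: "\<And>x. E x = 0 \<longleftrightarrow> E' x = 0"
    using assms by (auto simp: is_projection_def fun_eq_iff)
  obtain y where "E x = E' y" using U by blast
  then have "E' (E x) = E x" by (simp add: idem)
  moreover have "E (x - E x) = 0" by (simp add: lin_diff[OF lin(1)] idem)
  then have "E' (x - E x) = 0" by (simp add: W)
  ultimately show "E x = E' x" by (simp add: lin_diff[OF lin(2)])
qed

text \<open>Distinct eigenvalues make the eigenspace the line through \<open>b k\<close>, while the
  other eigenspaces span the kernel of the \<open>k\<close>-th coordinate; the coordinate projection
  therefore has the defining property.\<close>

lemma primitive_idempotent_diag:
  assumes b: "ordered_basis d b" "lin T" "\<And>i. i \<le> d \<Longrightarrow> T (b i) = t i *s b i"
    and inj: "inj_on t {..d}" and k: "k \<le> d"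
  shows "primitive_idempotent T (t k) = (\<lambda>x. coord d b x k *s b k)"
proof -
  let ?E = "\<lambda>x. coord d b x k *s b k"
  have eig: "eigenspace T (t k) = range ?E"
  proof -
    have "x = coord d b x k *s b k" if "T x = t k *s x" for x
    proof (rule coord_eqI[OF b(1)])
      fix j assume j: "j \<le> d"
      show "coord d b x j = coord d b (coord d b x k *s b k) j"
      proof (cases "j = k")
        case True
        then show ?thesis using b k by (simp add: coord_scale coord_basis)
      next
        case False
        then have "t j \<noteq> t k" using inj j k by (auto dest: inj_onD)
        then show ?thesis using eigen_coord_zero[OF b that j] b k j False
          by (simp add: coord_scale coord_basis)
      qed
    qed
    note fwd = this
    have bwd: "T (c *s b k) = t k *s (c *s b k)" for c
      unfolding lin_scale[OF b(2)] b(3)[OF k] by (rule scale_left_commute)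
    show ?thesis
      unfolding eigenspace_def
    proof (intro equalityI subsetI)
      fix x assume "x \<in> {v. T v = t k *s v}"
      then have "x = coord d b x k *s b k" by (intro fwd) simp
      then show "x \<in> range (\<lambda>x. coord d b x k *s b k)" by (rule range_eqI)
    next
      fix x assume "x \<in> range (\<lambda>x. coord d b x k *s b k)"
      then obtain y where "x = coord d b y k *s b k" by (rule rangeE)
      then show "x \<in> {v. T v = t k *s v}" by (simp only: bwd mem_Collect_eq)
    qed
  qed
  let ?S = "span (\<Union>y\<in>eigenvalues T - {t k}. eigenspace T y)"
  have "?S = {x. ?E x = 0}"
  proof
    show "?S \<subseteq> {x. ?E x = 0}"
    proof (rule span_minimal)
      show "subspace {x. ?E x = 0}"
        by (simp add: subspace_def coord_zero[OF b(1)] coord_add[OF b(1)] coord_scale[OF b(1)]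
            ordered_basis_nonzero[OF b(1) k])
      show "(\<Union>y\<in>eigenvalues T - {t k}. eigenspace T y) \<subseteq> {x. ?E x = 0}"
      proof
        fix x assume "x \<in> (\<Union>y\<in>eigenvalues T - {t k}. eigenspace T y)"
        then obtain y where "y \<noteq> t k" "T x = y *s x" by (auto simp: eigenspace_def)
        then have "coord d b x k = 0" using eigen_coord_zero[OF b _ k, of x y] by metis
        then show "x \<in> {x. ?E x = 0}" by simp
      qed
    qed
    show "{x. ?E x = 0} \<subseteq> ?S"
    proof
      fix x assume "x \<in> {x. ?E x = 0}"
      then have 0: "coord d b x k = 0" using ordered_basis_nonzero[OF b(1) k] by simp
      have "(\<Sum>j\<le>d. coord d b x j *s b j) \<in> ?S"
      proof (rule span_sum)
        fix j assume "j \<in> {..d}"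
        show "coord d b x j *s b j \<in> ?S"
        proof (cases "j = k")
          case False
          then have "t j \<noteq> t k" using inj \<open>j \<in> {..d}\<close> k by (auto dest: inj_onD)
          moreover have "b j \<in> eigenspace T (t j)" using b(3) \<open>j \<in> {..d}\<close> by (simp add: eigenspace_def)
          ultimately show ?thesis
            using eigenvalues_diag[OF b] \<open>j \<in> {..d}\<close> by (intro span_scale span_base) auto
        qed (simp add: 0 span_zero)
      qed
      then show "x \<in> ?S" by (simp add: coord_sum[OF b(1)])
    qed
  qed
  moreover have "lin ?E"
    by (simp add: lin_iff coord_add[OF b(1)] coord_scale[OF b(1)] scale_left_distrib)
  moreover have "?E \<circ> ?E = ?E"
    using b k by (auto simp: fun_eq_iff coord_scale coord_basis)
  ultimately have proj: "is_projection ?E (eigenspace T (t k)) ?S"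
    unfolding is_projection_def using eig by simp
  show ?thesis
    unfolding primitive_idempotent_def
    by (rule the_equality, rule proj, rule is_projection_unique[OF _ proj])
qed

text \<open>Compressing \<open>A\<close> by the idempotent for \<open>t i\<close> leaves only the
  entry in row and column \<open>i\<close>, so the sum is the diagonal part of \<open>A\<close> on
  \<open>b\<close>.\<close>

lemma flat_part_diag:
  assumes b: "ordered_basis d b" "lin As" "\<And>i. i \<le> d \<Longrightarrow> As (b i) = t i *s b i"
    and inj: "inj_on t {..d}" and A: "lin A"
  shows "flat_part A As x = (\<Sum>i\<le>d. (coord d b x i * coord d b (A (b i)) i) *s b i)"
proof -
  have "flat_part A As x = (\<Sum>i\<le>d. primitive_idempotent As (t i) (A (primitive_idempotent As (t i) x)))"
    using sum.reindex[OF inj] eigenvalues_diag[OF b] by (simp add: flat_part_def)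
  also have "\<dots> = (\<Sum>i\<le>d. (coord d b x i * coord d b (A (b i)) i) *s b i)"
    by (intro sum.cong refl)
      (simp add: primitive_idempotent_diag[OF b inj] lin_scale[OF A] coord_scale[OF b(1)])
  finally show ?thesis .
qed

lemma ordered_basis_cong:
  assumes "\<And>i. i \<le> d \<Longrightarrow> b i = b' i"
  shows "ordered_basis d b \<longleftrightarrow> ordered_basis d b'"
proof -
  have "b ` {..d} = b' ` {..d}" using assms by (intro image_cong) auto
  moreover have "inj_on b {..d} \<longleftrightarrow> inj_on b' {..d}" using assms by (intro inj_on_cong) auto
  ultimately show ?thesis by (simp add: ordered_basis_def)
qed

text \<open>Reversing both bases reduces this to the other triangular case.\<close>

lemma ordered_basis_triangular_lower:
  assumes v: "ordered_basis d v"
    and lower: "\<And>i j. j < i \<Longrightarrow> i \<le> d \<Longrightarrow> coord d v (w i) j = 0"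
    and diag: "\<And>i. i \<le> d \<Longrightarrow> coord d v (w i) i \<noteq> 0"
  shows "ordered_basis d w"
proof -
  have "ordered_basis d (\<lambda>i. w (d - i))"
  proof (rule ordered_basis_triangular[OF ordered_basis_rev[OF v]])
    fix i j assume "i < j" "j \<le> d"
    then show "coord d (\<lambda>i. v (d - i)) (w (d - i)) j = 0"
      unfolding coord_rev by (intro lower) auto
  next
    fix i assume "i \<le> d"
    then show "coord d (\<lambda>i. v (d - i)) (w (d - i)) i \<noteq> 0"
      unfolding coord_rev by (intro diag) auto
  qed
  from ordered_basis_rev[OF this] show ?thesis
    by (subst ordered_basis_cong[of d w "\<lambda>i. w (d - (d - i))"]) auto
qed

section \<open>Split bases\<close>

text \<open>Read by rows, the bidiagonal form becomes a two-term recursion for the coordinates of an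
  eigenvector.\<close>

lemma coord_lower_bidiagonal:
  assumes w: "ordered_basis d w" and B: "lin B"
    and Bw: "\<And>i. i \<le> d \<Longrightarrow> B (w i) = t i *s w i + (if i = d then 0 else w (i + 1))"
    and j: "j \<le> d"
  shows "coord d w (B x) j = t j * coord d w x j + (if j = 0 then 0 else coord d w x (j - 1))"
proof -
  have "coord d w (B x) j = (\<Sum>i\<le>d. coord d w x i * coord d w (B (w i)) j)"
    by (rule coord_lin[OF w B])
  \<comment> \<open>For \<open>j = 0\<close> the truncated \<open>j - 1\<close> is 0 again; the
    inner test makes the second summand vanish there.\<close>
  also have "\<dots> = (\<Sum>i\<le>d. (if i = j then t j * coord d w x j else 0) +
      (if i = j - 1 then if j = 0 then 0 else coord d w x (j - 1) else 0))"
  proof (intro sum.cong refl)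
    fix i assume "i \<in> {..d}"
    then have i: "i \<le> d" by simp
    have "coord d w (if i = d then 0 else w (i + 1)) j = (if i + 1 = j then 1 else 0)"
      using i j by (auto simp: coord_zero[OF w] coord_basis[OF w])
    then show "coord d w x i * coord d w (B (w i)) j = (if i = j then t j * coord d w x j else 0) +
      (if i = j - 1 then if j = 0 then 0 else coord d w x (j - 1) else 0)"
      using i j by (auto simp: Bw coord_add[OF w] coord_scale[OF w] coord_basis[OF w] distrib_left)
  qed
  also have "\<dots> = t j * coord d w x j + (if j = 0 then 0 else coord d w x (j - 1))"
  proof -
    have "j - 1 \<le> d" using j by simp
    with j show ?thesis by (simp add: sum.distrib)
  qed
  finally show ?thesis .
qed

lemma coord_upper_bidiagonal:
  assumes w: "ordered_basis d w" and K: "lin K"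
    and Kw: "\<And>i. i \<le> d \<Longrightarrow> K (w i) = k i *s w i + (if i = 0 then 0 else \<phi> i *s w (i - 1))"
    and j: "j \<le> d"
  shows "coord d w (K x) j = k j * coord d w x j + (if j = d then 0 else \<phi> (j + 1) * coord d w x (j + 1))"
proof -
  have "coord d w (K x) j = (\<Sum>i\<le>d. coord d w x i * coord d w (K (w i)) j)"
    by (rule coord_lin[OF w K])
  also have "\<dots> = (\<Sum>i\<le>d. (if i = j then k j * coord d w x j else 0) +
      (if i = j + 1 then \<phi> (j + 1) * coord d w x (j + 1) else 0))"
  proof (intro sum.cong refl)
    fix i assume "i \<in> {..d}"
    then have i: "i \<le> d" by simp
    have "coord d w (if i = 0 then 0 else \<phi> i *s w (i - 1)) j = (if i = j + 1 then \<phi> i else 0)"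
      using i j by (auto simp: coord_zero[OF w] coord_scale[OF w] coord_basis[OF w])
    then show "coord d w x i * coord d w (K (w i)) j = (if i = j then k j * coord d w x j else 0) +
      (if i = j + 1 then \<phi> (j + 1) * coord d w x (j + 1) else 0)"
      using i j by (auto simp: Kw coord_add[OF w] coord_scale[OF w] coord_basis[OF w] distrib_left)
  qed
  also have "\<dots> = k j * coord d w x j + (if j = d then 0 else \<phi> (j + 1) * coord d w x (j + 1))"
    using j by (simp add: sum.distrib)
  finally show ?thesis .
qed

text \<open>The eigenvector for \<open>t i\<close> has coordinates 0 before \<open>i\<close> and 1
  at \<open>i\<close>; distinctness of the \<open>t j\<close> lets the recursion determine the later
  ones. These vectors are triangular over \<open>w\<close>.\<close>

lemma lower_bidiagonal_eigenbasis:
  assumes w: "ordered_basis d w" and B: "lin B"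
    and Bw: "\<And>i. i \<le> d \<Longrightarrow> B (w i) = t i *s w i + (if i = d then 0 else w (i + 1))"
    and inj: "inj_on t {..d}"
  obtains z where "ordered_basis d z" "\<And>i. i \<le> d \<Longrightarrow> B (z i) = t i *s z i"
proof -
  \<comment> \<open>The solution of \<open>a i j * (t i - t j) = a i (j - 1)\<close> with
    \<open>a i i = 1\<close>, the empty product.\<close>
  define a where "a i j = (if j < i then 0 else \<Prod>m\<in>{i<..j}. inverse (t i - t m))" for i j
  have a_step: "a i j * (t i - t j) = (if j = 0 then 0 else a i (j - 1))" if "i \<le> d" "j \<le> d" for i j
  proof (cases "i < j")
    case True
    then obtain l where l: "j = Suc l" "i \<le> l" by (cases j) auto
    have ne: "t i \<noteq> t j" using inj that True by (auto dest: inj_onD)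
    have "{i<..j} = insert j {i<..l}" using l by auto
    then have "a i j = inverse (t i - t j) * a i l" using l by (simp add: a_def)
    then show ?thesis using l ne by simp
  next
    case False
    then show ?thesis by (auto simp: a_def)
  qed
  define z where "z i = (\<Sum>j\<le>d. a i j *s w j)" for i
  have coord_z: "coord d w (z i) j = a i j" if "j \<le> d" for i j
    unfolding z_def using w that by (rule coord_of_sum)
  show ?thesis
  proof
    show "ordered_basis d z"
      by (rule ordered_basis_triangular_lower[OF w]) (simp_all add: coord_z a_def)
    fix i assume i: "i \<le> d"
    show "B (z i) = t i *s z i"
    proof (rule coord_eqI[OF w])
      fix j assume j: "j \<le> d"
      have "coord d w (B (z i)) j = t j * a i j + (if j = 0 then 0 else a i (j - 1))"
        using coord_lower_bidiagonal[OF w B Bw j, of "z i"] j by (simp add: coord_z)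
      also have "\<dots> = t j * a i j + a i j * (t i - t j)"
        using a_step[OF i j] by simp
      also have "\<dots> = coord d w (t i *s z i) j"
        using j by (simp add: coord_scale[OF w] coord_z algebra_simps)
      finally show "coord d w (B (z i)) j = coord d w (t i *s z i) j" .
    qed
  qed
qed

text \<open>With respect to \<open>w\<close>, the eigenvectors \<open>z i\<close> are triangular, so that the shape of \<open>K\<close> above
  the diagonal carries over from \<open>w\<close> to \<open>z\<close>.\<close>

lemma split_eigenbasis_coord:
  assumes w: "ordered_basis d w" and B: "lin B" and K: "lin K"
    and Bw: "\<And>i. i \<le> d \<Longrightarrow> B (w i) = t i *s w i + (if i = d then 0 else w (i + 1))"
    and Kw: "\<And>i. i \<le> d \<Longrightarrow> K (w i) = k i *s w i + (if i = 0 then 0 else \<phi> i *s w (i - 1))"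
    and inj: "inj_on t {..d}" and \<phi>: "\<And>i. 1 \<le> i \<Longrightarrow> i \<le> d \<Longrightarrow> \<phi> i \<noteq> 0"
    and z: "ordered_basis d z" and Bz: "\<And>i. i \<le> d \<Longrightarrow> B (z i) = t i *s z i"
  shows "i \<le> d \<Longrightarrow> j + 1 < i \<Longrightarrow> coord d z (K (z i)) j = 0"
    and "i < d \<Longrightarrow> coord d z (K (z (i + 1))) i \<noteq> 0"
proof -
  let ?x = "\<lambda>i. coord d w (z i)"
  \<comment> \<open>Coordinate \<open>j\<close> of the eigenvector equation. Where
    \<open>t i\<close> and \<open>t j\<close> differ, it determines \<open>?x i j\<close> from the
    preceding coordinate.\<close>
  have rec: "(t i - t j) * ?x i j = (if j = 0 then 0 else ?x i (j - 1))" if "i \<le> d" "j \<le> d" for i j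
    using coord_lower_bidiagonal[OF w B Bw that(2), of "z i"] that
    by (simp add: Bz coord_scale[OF w] algebra_simps)
  have low: "?x i j = 0" if "j < i" "i \<le> d" for i j
    using that
  proof (induction j)
    case 0
    then have "t i \<noteq> t 0" using inj by (auto dest: inj_onD)
    then show ?case using rec[of i 0] 0 by simp
  next
    case (Suc j)
    then have "t i \<noteq> t (Suc j)" using inj by (auto dest: inj_onD)
    then show ?case using rec[of i "Suc j"] Suc by simp
  qed
  \<comment> \<open>If the leading coordinate vanished, the recursion would pass 0 on to all later
    ones and \<open>z i\<close> would be 0.\<close>
  have diag: "?x i i \<noteq> 0" if i: "i \<le> d" for i
  proof
    assume 0: "?x i i = 0"
    have "?x i j = 0" if "j \<le> d" for j
      using that
    proof (induction j)
      case 0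
      then show ?case using low[of 0 i] i \<open>?x i i = 0\<close> by (cases "i = 0") auto
    next
      case (Suc j)
      consider "Suc j < i" | "Suc j = i" | "i < Suc j" by linarith
      then show ?case
      proof cases
        case 3
        then have "t i \<noteq> t (Suc j)" using inj i Suc.prems by (auto dest: inj_onD)
        then show ?thesis using rec[of i "Suc j"] i Suc by simp
      qed (use 0 low i in auto)
    qed
    then have "z i = 0" by (intro coord_eqI[OF w]) (simp add: coord_zero[OF w])
    then show False using ordered_basis_nonzero[OF z i] by simp
  qed
  \<comment> \<open>Forward substitution: a vector without \<open>w\<close>-coordinates below
    \<open>m\<close> has no \<open>z\<close>-coordinates there either, and its two coordinates at
    \<open>m\<close> are proportional with factor \<open>?x m m\<close>.\<close>
  have lead: "coord d w y j = coord d z y j * ?x j j \<and> (j < m \<longrightarrow> coord d z y j = 0)"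
    if y: "\<And>j. j < m \<Longrightarrow> coord d w y j = 0" and "j \<le> m" "m \<le> d" for y m j
    using \<open>j \<le> m\<close>
  proof (induction j rule: less_induct)
    case (less j)
    then have j: "j \<le> d" using \<open>m \<le> d\<close> by simp
    have "coord d w y j = coord d w (\<Sum>l\<le>d. coord d z y l *s z l) j"
      by (simp only: coord_sum[OF z])
    also have "\<dots> = (\<Sum>l\<le>d. coord d z y l * ?x l j)"
      by (simp only: coord_sum_distrib[OF w] coord_scale[OF w])
    also have "\<dots> = (\<Sum>l\<le>d. if l = j then coord d z y j * ?x j j else 0)"
    proof (intro sum.cong refl)
      fix l assume "l \<in> {..d}"
      then show "coord d z y l * ?x l j = (if l = j then coord d z y j * ?x j j else 0)"
        using less low[of j l] by (cases l j rule: linorder_cases) auto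
    qed
    also have "\<dots> = coord d z y j * ?x j j" using j by simp
    finally have "coord d w y j = coord d z y j * ?x j j" .
    then show ?case using y[of j] diag[OF j] by auto
  qed
  have Kz: "coord d w (K (z i)) j = k j * ?x i j + (if j = d then 0 else \<phi> (j + 1) * ?x i (j + 1))"
    if "j \<le> d" for i j
    using coord_upper_bidiagonal[OF w K Kw that] by blast
  have Kz_low: "coord d w (K (z i)) j = 0" if "j + 1 < i" "i \<le> d" for i j
    using Kz[of j i] low[of j i] low[of "j + 1" i] that by simp
  show "coord d z (K (z i)) j = 0" if "i \<le> d" "j + 1 < i" for i j
    using lead[of "i - 1" "K (z i)" j] Kz_low[of _ i] that by simp
  show "coord d z (K (z (i + 1))) i \<noteq> 0" if "i < d" for i
  proof -
    \<comment> \<open>Only the superdiagonal term survives, as \<open>z (i + 1)\<close> has no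
      coordinate at \<open>i\<close>.\<close>
    have "coord d w (K (z (i + 1))) i \<noteq> 0"
      using Kz[of i "i + 1"] low[of i "i + 1"] diag[of "i + 1"] \<phi>[of "i + 1"] that by simp
    then show ?thesis using lead[of i "K (z (i + 1))" i] Kz_low[of _ "i + 1"] that by auto
  qed
qed

section \<open>Products of shifts of one map\<close>

text \<open>The product of the maps \<open>B - t l\<close> for \<open>l < i\<close>, applied to
  \<open>x\<close>. With \<open>x\<close> the first vector of an eigenbasis of the other map, these
  are the candidates for a split basis.\<close>

primrec ladder :: "('b \<Rightarrow> 'b) \<Rightarrow> (nat \<Rightarrow> 'a) \<Rightarrow> 'b \<Rightarrow> nat \<Rightarrow> 'b" where
  "ladder B t x 0 = x"
| "ladder B t x (Suc i) = B (ladder B t x i) - t i *s ladder B t x i"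

lemma ladder_fold: "ladder B t x i = fold (\<lambda>c y. B y - c *s y) (map t [0..<i]) x"
  by (induction i) simp_all

text \<open>All factors are polynomials in \<open>B\<close> and commute, so the full product of
  \<open>d + 1\<close> factors does not depend on their order.\<close>

lemma ladder_rev:
  assumes B: "lin B"
  shows "ladder B (\<lambda>i. t (d - i)) x (Suc d) = ladder B t x (Suc d)"
proof -
  have "map (\<lambda>i. t (d - i)) [0..<Suc d] = rev (map t [0..<Suc d])"
    by (intro nth_equalityI) (simp_all add: rev_nth del: upt_Suc)
  then show ?thesis
    unfolding ladder_fold
    by (subst fold_rev[symmetric])
      (auto simp: fun_eq_iff lin_diff[OF B] lin_scale[OF B] scale_right_diff_distrib mult.commute)
qed

lemma ladder_cong:
  "(\<And>j. j < i \<Longrightarrow> t j = t' j) \<Longrightarrow> ladder B t x i = ladder B t' x i"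
  by (induction i) simp_all

text \<open>If \<open>S\<close> multiplies \<open>v j\<close> by \<open>(-1) ^ j\<close>, the parity
  hypothesis says \<open>S B S = - B\<close>. So negating the scalars conjugates each factor by
  \<open>S\<close> and changes its sign, and \<open>S\<close> fixes \<open>v 0\<close>.\<close>

lemma ladder_parity:
  assumes v: "ordered_basis d v" and B: "lin B"
    and even: "\<And>j l. j \<le> d \<Longrightarrow> l \<le> d \<Longrightarrow> even (j + l) \<Longrightarrow> coord d v (B (v l)) j = 0"
    and j: "j \<le> d"
  shows "coord d v (ladder B (\<lambda>i. - t i) (v 0) i) j = (-1) ^ (i + j) * coord d v (ladder B t (v 0) i) j"
  using j
proof (induction i arbitrary: j)
  case 0
  then show ?case by (simp add: coord_basis[OF v])
next
  case (Suc i)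
  let ?w = "ladder B t (v 0) i" and ?w' = "ladder B (\<lambda>i. - t i) (v 0) i"
  have "coord d v (B ?w') j = (\<Sum>l\<le>d. coord d v ?w' l * coord d v (B (v l)) j)"
    by (rule coord_lin[OF v B])
  also have "\<dots> = (\<Sum>l\<le>d. (-1) ^ (Suc i + j) * (coord d v ?w l * coord d v (B (v l)) j))"
  proof (intro sum.cong refl)
    fix l assume "l \<in> {..d}"
    then have l: "l \<le> d" by simp
    show "coord d v ?w' l * coord d v (B (v l)) j =
      (-1) ^ (Suc i + j) * (coord d v ?w l * coord d v (B (v l)) j)"
    proof (cases "even (j + l)")
      case True
      then show ?thesis using even[OF Suc.prems l] by simp
    next
      case False
      then have "(-1 :: 'a) ^ (i + l) = (-1) ^ (Suc i + j)" by (auto simp: minus_one_power_iff)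
      then show ?thesis using Suc.IH[OF l] by simp
    qed
  qed
  also have "\<dots> = (-1) ^ (Suc i + j) * coord d v (B ?w) j"
    by (simp only: coord_lin[OF v B, of ?w] sum_distrib_left)
  finally show ?case
    using Suc.IH[OF Suc.prems]
    by (simp add: coord_diff[OF v] coord_scale[OF v] coord_add[OF v] algebra_simps)
qed

text \<open>Up to \<open>d\<close>, an irreducible tridiagonal map raises the top index by exactly
  one each time, with a nonzero factor. This supplies the hypotheses of
  \<open>ordered_basis_triangular\<close>.\<close>

lemma ladder_triangular:
  assumes v: "ordered_basis d v" and B: "lin B"
    and irr: "irreducible_tridiagonal (matrix_of d v B)"
  shows "i < j \<Longrightarrow> j \<le> d \<Longrightarrow> coord d v (ladder B t (v 0) i) j = 0"
    and "i \<le> d \<Longrightarrow> coord d v (ladder B t (v 0) i) i \<noteq> 0"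
proof -
  have M0: "coord d v (B (v l)) j = 0" if "l + 1 < j" "j \<le> d" for l j
    using irr that unfolding irreducible_tridiagonal_matrix_of by simp
  have M1: "coord d v (B (v l)) (l + 1) \<noteq> 0" if "l < d" for l
  proof -
    have "l \<le> d" "l + 1 \<le> d" using that by simp_all
    then show ?thesis using irr unfolding irreducible_tridiagonal_matrix_of by blast
  qed
  have up: "coord d v (ladder B t (v 0) i) j = 0" if "i < j" "j \<le> d" for i j
    using that
  proof (induction i arbitrary: j)
    case 0
    then show ?case by (simp add: coord_basis[OF v])
  next
    case (Suc i)
    have "coord d v (B (ladder B t (v 0) i)) j =
        (\<Sum>l\<le>d. coord d v (ladder B t (v 0) i) l * coord d v (B (v l)) j)"
      by (rule coord_lin[OF v B])
    also have "\<dots> = 0"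
    proof (intro sum.neutral ballI)
      fix l assume "l \<in> {..d}"
      then show "coord d v (ladder B t (v 0) i) l * coord d v (B (v l)) j = 0"
        using Suc.IH[of l] M0[of l j] Suc.prems by (cases "i < l") auto
    qed
    finally show ?case
      using Suc.IH[of j] Suc.prems by (simp add: coord_diff[OF v] coord_scale[OF v])
  qed
  show "coord d v (ladder B t (v 0) i) j = 0" if "i < j" "j \<le> d"
    using up that .
  show "coord d v (ladder B t (v 0) i) i \<noteq> 0" if "i \<le> d"
    using that
  proof (induction i)
    case 0
    then show ?case by (simp add: coord_basis[OF v])
  next
    case (Suc i)
    let ?w = "ladder B t (v 0) i"
    have "coord d v (B ?w) (i + 1) = (\<Sum>l\<le>d. coord d v ?w l * coord d v (B (v l)) (i + 1))"
      by (rule coord_lin[OF v B])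
    also have "\<dots> = (\<Sum>l\<le>d. if l = i then coord d v ?w i * coord d v (B (v i)) (i + 1) else 0)"
    proof (intro sum.cong refl)
      fix l assume "l \<in> {..d}"
      then show "coord d v ?w l * coord d v (B (v l)) (i + 1) =
          (if l = i then coord d v ?w i * coord d v (B (v i)) (i + 1) else 0)"
        using up[of i l] M0[of l "i + 1"] Suc.prems by (cases l i rule: linorder_cases) auto
    qed
    also have "\<dots> = coord d v ?w i * coord d v (B (v i)) (i + 1)" using Suc.prems by simp
    finally show ?case
      using up[of i "Suc i"] M1[of i] Suc by (simp add: coord_diff[OF v] coord_scale[OF v])
  qed
qed

text \<open>The relation \<open>rel\<close> is \<open>[B, [B, K]] = n\<^sup>2 K\<close> solved for
  \<open>K B B\<close>. It expresses \<open>K\<close> on \<open>w (i + 2)\<close> through its values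
  on \<open>w i\<close> and \<open>w (i + 1)\<close>, so the bidiagonal shape propagates along the
  ladder that starts at \<open>v 0\<close>.\<close>

lemma krawtchouk_split:
  fixes e m n :: 'a
  assumes v: "ordered_basis d v" and B: "lin B" and K: "lin K"
    and d: "2 \<le> d" and e: "of_nat d = 2 * e" and m: "m \<noteq> 0"
    and inj: "inj_on (of_nat :: nat \<Rightarrow> 'a) {..d}"
    and Kv: "\<And>i. i \<le> d \<Longrightarrow> K (v i) = (m * (of_nat i - e)) *s v i"
    and irr: "irreducible_tridiagonal (matrix_of d v B)"
    and zero_diag: "\<And>i. i \<le> d \<Longrightarrow> coord d v (B (v i)) i = 0"
    and rel: "\<And>x. K (B (B x)) = n\<^sup>2 *s K x - B (B (K x)) + 2 *s B (K (B x))"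
  obtains w where "ordered_basis d w"
    "\<And>i. i \<le> d \<Longrightarrow> B (w i) = (n * (of_nat i - e)) *s w i + (if i = d then 0 else w (i + 1))"
    "\<And>i. i \<le> d \<Longrightarrow> K (w i) = (m * (of_nat i - e)) *s w i +
      (if i = 0 then 0 else (- n * m * of_nat i * (of_nat d - of_nat i + 1) / 2) *s w (i - 1))"
proof -
  have two: "(2 :: 'a) \<noteq> 0"
    using inj_onD[OF inj, of 2 0] d by auto
  define t where "t i = n * (of_nat i - e)" for i
  define k where "k i = m * (of_nat i - e)" for i
  \<comment> \<open>Equivalently, the sum of \<open>m * t l\<close> over \<open>l < i\<close>; the
    increments are recorded in \<open>\<phi>S\<close>.\<close>
  define \<phi> where "\<phi> i = - n * m * of_nat i * (of_nat d - of_nat i + 1) / 2" for i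
  define w where "w = ladder B t (v 0)"
  have w0: "w 0 = v 0" and wS: "w (Suc i) = B (w i) - t i *s w i" for i
    by (simp_all add: w_def)
  have Bw: "B (w i) = t i *s w i + w (Suc i)" for i by (simp add: wS)
  have basis: "ordered_basis d w"
    unfolding w_def
    by (rule ordered_basis_triangular[OF v]) (use ladder_triangular[OF v B irr] in auto)
  note lins = lin_add[OF B] lin_add[OF K] lin_diff[OF B] lin_diff[OF K] lin_scale[OF B] lin_scale[OF K]
  note coords = coord_add[OF v] coord_diff[OF v] coord_scale[OF v]
  have K0: "K (w 0) = k 0 *s w 0" using Kv[of 0] by (simp add: w0 k_def)
  have K1: "K (w 1) = k 1 *s w 1 + \<phi> 1 *s w 0"
  proof -
    define y where "y = coord d v (B (v 0)) 1"
    \<comment> \<open>Tridiagonality and the zero diagonal leave a multiple of \<open>v 1\<close>,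
      on which \<open>K\<close> acts as \<open>k 1\<close>.\<close>
    have "B (v 0) = y *s v 1"
    proof (rule coord_eqI[OF v])
      fix j assume j: "j \<le> d"
      have "coord d v (B (v 0)) j = 0" if "j \<noteq> 1"
        using zero_diag[of 0] irr j that unfolding irreducible_tridiagonal_matrix_of
        by (cases "j = 0") auto
      then show "coord d v (B (v 0)) j = coord d v (y *s v 1) j"
        using j d by (auto simp: y_def coords coord_basis[OF v])
    qed
    then have "K (B (w 0)) = k 1 *s B (w 0)"
      using Kv[of 1] d by (simp add: w0 lins k_def mult.commute)
    moreover have "K (w 1) = K (B (w 0)) - t 0 *s K (w 0)"
      using wS[of 0] by (simp add: lins)
    ultimately have "K (w 1) = k 1 *s (t 0 *s w 0 + w 1) - t 0 *s (k 0 *s w 0)"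
      using Bw[of 0] by (simp only: K0 One_nat_def)
    also have "\<dots> = k 1 *s w 1 + (k 1 * t 0 - t 0 * k 0) *s w 0"
      by (simp add: algebra_simps)
    also have "k 1 * t 0 - t 0 * k 0 = \<phi> 1"
      using two by (simp add: k_def t_def \<phi>_def e field_simps)
    finally show ?thesis .
  qed
  \<comment> \<open>Two consecutive statements are carried because the relation has order two. The
    index may exceed \<open>d\<close>, since \<open>w (Suc d)\<close> must be shown to vanish; at
    \<open>i = 0\<close> the truncated \<open>w (i - 1)\<close> is harmless because
    \<open>\<phi> 0 = 0\<close>.\<close>
  have Kw: "K (w i) = k i *s w i + \<phi> i *s w (i - 1) \<and> K (w (Suc i)) = k (Suc i) *s w (Suc i) + \<phi> (Suc i) *s w i"
    for i
  proof (induction i)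
    case 0
    then show ?case using K0 K1 by (simp add: \<phi>_def)
  next
    case (Suc i)
    then have Ki: "K (w i) = k i *s w i + \<phi> i *s w (i - 1)"
      and Ki1: "K (w (Suc i)) = k (Suc i) *s w (Suc i) + \<phi> (Suc i) *s w i" by auto
    \<comment> \<open>This is \<open>t (i - 1)\<close> for positive \<open>i\<close>. It occurs only
      together with the factor \<open>\<phi> i\<close>, which vanishes at 0.\<close>
    define s where "s = t i - n"
    have Bi: "\<phi> i *s B (w (i - 1)) = \<phi> i *s (s *s w (i - 1) + w i)"
      by (cases i) (simp_all add: \<phi>_def Bw s_def t_def algebra_simps)
    have BBi: "\<phi> i *s B (B (w (i - 1))) = \<phi> i *s (s *s (s *s w (i - 1) + w i) + (t i *s w i + w (Suc i)))"
    proof -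
      have "\<phi> i *s B (B (w (i - 1))) = B (\<phi> i *s B (w (i - 1)))" by (simp only: lins)
      also have "\<dots> = \<phi> i *s (s *s B (w (i - 1)) + B (w i))"
        by (simp only: Bi lins)
      also have "\<dots> = s *s (\<phi> i *s B (w (i - 1))) + \<phi> i *s B (w i)"
        by (simp add: scale_right_distrib mult.commute)
      finally show ?thesis unfolding Bi by (simp add: Bw scale_right_distrib mult.commute)
    qed
    have \<phi>S: "\<phi> (Suc i) = \<phi> i + m * t i" "\<phi> (Suc (Suc i)) = \<phi> i + 2 * m * t i + m * n"
      using two by (simp_all add: \<phi>_def t_def e field_simps)
    have kS: "k (Suc i) = k i + m" "k (Suc (Suc i)) = k i + 2 * m" and tS: "t (Suc i) = t i + n"
      and mt: "m * t i = n * k i"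
      by (simp_all add: k_def t_def algebra_simps)
    have BBw: "B (B (w i)) = t i *s (t i *s w i + w (Suc i)) + (t (Suc i) *s w (Suc i) + w (Suc (Suc i)))"
      by (simp only: Bw lins)
    have BBK: "B (B (K (w i))) = k i *s B (B (w i)) + \<phi> i *s B (B (w (i - 1)))"
      by (simp only: Ki lins)
    have KB: "K (B (w i)) = t i *s K (w i) + K (w (Suc i))"
      by (simp only: Bw lins)
    have BKB: "B (K (B (w i))) = t i *s (k i *s B (w i) + \<phi> i *s B (w (i - 1)))
        + (k (Suc i) *s B (w (Suc i)) + \<phi> (Suc i) *s B (w i))"
      by (simp only: KB Ki Ki1 lins)
    \<comment> \<open>A quadratic polynomial in \<open>B\<close> applied to \<open>w i\<close>, so
      that \<open>rel\<close> applies to its leading term.\<close>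
    have "w (Suc (Suc i)) = B (B (w i)) - t i *s B (w i) - t (Suc i) *s (B (w i) - t i *s w i)"
      by (simp only: wS lins)
    then have "K (w (Suc (Suc i))) = K (B (B (w i))) - t i *s K (B (w i)) - t (Suc i) *s (K (B (w i)) - t i *s K (w i))"
      by (simp only: lins)
    also have "K (B (B (w i))) = n\<^sup>2 *s K (w i) - B (B (K (w i))) + 2 *s B (K (B (w i)))"
      by (rule rel)
    finally have eq: "K (w (Suc (Suc i))) = n\<^sup>2 *s K (w i) - B (B (K (w i))) + 2 *s B (K (B (w i)))
        - t i *s K (B (w i)) - t (Suc i) *s (K (B (w i)) - t i *s K (w i))" .
    have "K (w (Suc (Suc i))) = k (Suc (Suc i)) *s w (Suc (Suc i)) + \<phi> (Suc (Suc i)) *s w (Suc i)"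
    proof (rule coord_eqI[OF v])
      fix j
      define a b c f where "a = coord d v (w (Suc (Suc i))) j" and "b = coord d v (w (Suc i)) j"
        and "c = coord d v (w i) j" and "f = coord d v (w (i - 1)) j"
      note abcf = this
      \<comment> \<open>The terms in \<open>w (i - 1)\<close> cancel, and the remaining coefficient
        of \<open>w i\<close> is zero by \<open>mt\<close>.\<close>
      have "coord d v (K (w (Suc (Suc i)))) j = (k i + 2 * m) * a + (\<phi> i + 2 * m * t i + m * n) * b
          + n * (n * k i - m * t i) * c"
        unfolding eq BBK BKB unfolding KB Ki Ki1 BBi BBw unfolding Bi unfolding Bw
        unfolding \<phi>S kS tS s_def coords abcf[symmetric]
        by (simp add: algebra_simps power2_eq_square)
      then show "coord d v (K (w (Suc (Suc i)))) j =
        coord d v (k (Suc (Suc i)) *s w (Suc (Suc i)) + \<phi> (Suc (Suc i)) *s w (Suc i)) j"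
        by (simp add: mt \<phi>S kS coords abcf)
    qed
    with Ki1 show ?case by simp
  qed
  \<comment> \<open>\<open>w (Suc d)\<close> is an eigenvector of \<open>K\<close> for the scalar \<open>k (Suc d)\<close>, which is an eigenvalue only in
    characteristic \<open>d + 1\<close>, where it equals \<open>k 0\<close>.  Then \<open>d\<close> is even and \<open>w (Suc d)\<close> is an odd
    polynomial in \<open>B\<close> applied to \<open>v 0\<close>, so its coordinate at \<open>v 0\<close> vanishes.\<close>
  have "w (Suc d) = 0"
  proof (rule coord_eqI[OF v])
    fix j assume j: "j \<le> d"
    have "K (w (Suc d)) = k (Suc d) *s w (Suc d)"
      using Kw[of d] by (simp add: \<phi>_def)
    show "coord d v (w (Suc d)) j = coord d v 0 j"
    proof (cases "k j = k (Suc d)")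
      case False
      then show ?thesis
        using eigen_coord_zero[OF v K Kv \<open>K (w (Suc d)) = _\<close> j] by (simp add: k_def coord_zero[OF v])
    next
      case True
      then have "of_nat j = (of_nat (Suc d) :: 'a)" using m by (simp add: k_def)
      then have dj: "of_nat (Suc d - j) = (0 :: 'a)" using j by (simp add: of_nat_diff)
      have j0: "j = 0"
      proof (rule ccontr)
        assume "j \<noteq> 0"
        then have "Suc d - j \<in> {..d}" "Suc d - j \<noteq> 0" using j by auto
        then show False using inj_onD[OF inj, of "Suc d - j" 0] dj by simp
      qed
      have "even d"
      proof (rule ccontr)
        assume "odd d"
        then obtain q where q: "Suc d = 2 * q" by (metis even_Suc evenE)
        then have "2 * of_nat q = (0 :: 'a)" using dj j0 by (metis diff_zero of_nat_mult of_nat_numeral)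
        then show False using inj_onD[OF inj, of q 0] q two d by auto
      qed
      \<comment> \<open>Since \<open>- t i = t (d - i)\<close>, negating the scalars only reverses
        the factors and keeps \<open>w (Suc d)\<close>; by parity it also changes the sign of the
        coordinate at 0.\<close>
      have "ladder B (\<lambda>i. - t i) (v 0) (Suc d) = ladder B (\<lambda>i. t (d - i)) (v 0) (Suc d)"
        by (rule ladder_cong) (simp add: t_def of_nat_diff e algebra_simps)
      then have "ladder B (\<lambda>i. - t i) (v 0) (Suc d) = w (Suc d)"
        unfolding ladder_rev[OF B] w_def .
      moreover have "coord d v (ladder B (\<lambda>i. - t i) (v 0) (Suc d)) 0 =
          (-1) ^ (Suc d + 0) * coord d v (w (Suc d)) 0"
        unfolding w_def
      proof (rule ladder_parity[OF v B])
        fix j l assume "j \<le> d" "l \<le> d" "even (j + l)"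
        then have "j = l \<or> j + 1 < l \<or> l + 1 < j" by presburger
        then show "coord d v (B (v l)) j = 0"
          using irr zero_diag[of j] \<open>j \<le> d\<close> \<open>l \<le> d\<close>
          unfolding irreducible_tridiagonal_matrix_of by blast
      qed simp
      ultimately have "2 * coord d v (w (Suc d)) 0 = 0"
        using \<open>even d\<close> by (simp add: eq_neg_iff_add_eq_0 flip: mult_2)
      then show ?thesis using two j0 by (simp add: coord_zero[OF v])
    qed
  qed
  then have "B (w i) = t i *s w i + (if i = d then 0 else w (i + 1))" if "i \<le> d" for i
    using Bw[of i] by auto
  moreover have "K (w i) = k i *s w i + (if i = 0 then 0 else \<phi> i *s w (i - 1))" for i
    using Kw[of i] K0 by auto
  ultimately show thesis
    using basis that[of w] unfolding t_def k_def \<phi>_def by blast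
qed

lemma lin_eqI:
  assumes "ordered_basis d b" "lin S" "lin T" "\<And>i. i \<le> d \<Longrightarrow> S (b i) = T (b i)"
  shows "S x = T x"
proof -
  have "S (\<Sum>i\<le>d. coord d b x i *s b i) = T (\<Sum>i\<le>d. coord d b x i *s b i)"
    by (simp add: lin_sum[OF assms(2)] lin_sum[OF assms(3)] lin_scale[OF assms(2)]
        lin_scale[OF assms(3)] assms(4))
  then show ?thesis by (simp add: coord_sum[OF assms(1)])
qed

lemma dim_ordered_basis:
  assumes "ordered_basis d b"
  shows "dim UNIV = d + 1"
proof -
  have "card (b ` {..d}) = dim UNIV"
    by (rule basis_card_eq_dim) (use assms in \<open>auto simp: ordered_basis_def\<close>)
  then show ?thesis using assms by (simp add: card_image ordered_basis_def)
qed

section \<open>Krawtchouk pairs and their contraction\<close>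

text \<open>A common eigenvector would be a multiple of some \<open>v k\<close>, but
  \<open>A (v k)\<close> has a nonzero coordinate at a neighbour of \<open>k\<close>. This later
  shows that the split scalars at \<open>d\<close> do not vanish.\<close>

lemma no_common_eigenvector:
  assumes v: "ordered_basis d v" and A: "lin A" and As: "lin As"
    and Av: "\<And>i. i \<le> d \<Longrightarrow> As (v i) = s i *s v i" and inj: "inj_on s {..d}"
    and irr: "irreducible_tridiagonal (matrix_of d v A)" and d: "1 \<le> d"
    and x: "A x = a *s x" "As x = b *s x"
  shows "x = 0"
proof (rule ccontr)
  assume "x \<noteq> 0"
  then obtain k where k: "k \<le> d" "coord d v x k \<noteq> 0"
    using coord_eqI[OF v, of x 0] by (auto simp: coord_zero[OF v])
  then have "s k = b" using eigen_coord_zero[OF v As Av x(2)] by blast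
  then have other: "coord d v x j = 0" if "j \<le> d" "j \<noteq> k" for j
    using eigen_coord_zero[OF v As Av x(2) that(1)] inj that k(1) by (auto dest: inj_onD)
  obtain l where l: "l \<le> d" "l = k + 1 \<or> k = l + 1"
    using k(1) d by (cases "k = d") (auto intro: that[of "k - 1"] that[of "k + 1"])
  have "coord d v (A x) l = (\<Sum>i\<le>d. coord d v x i * coord d v (A (v i)) l)"
    by (rule coord_lin[OF v A])
  also have "\<dots> = (\<Sum>i\<le>d. if i = k then coord d v x k * coord d v (A (v k)) l else 0)"
    by (intro sum.cong refl) (use other in auto)
  also have "\<dots> = coord d v x k * coord d v (A (v k)) l" using k by simp
  finally have "coord d v x k * coord d v (A (v k)) l = a * coord d v x l"
    by (simp add: x(1) coord_scale[OF v])
  also have "\<dots> = 0" using other[of l] l by auto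
  finally have "coord d v (A (v k)) l = 0" using k(2) by simp
  with irr k(1) l show False unfolding irreducible_tridiagonal_matrix_of by blast
qed

text \<open>Both sides are linear, so the double commutators are compared on the split basis, where
  they become polynomial identities in the index. For
  \<open>\<rho> = \<tau> - \<mu> * \<nu> / 2\<close> the scalar common to both relations is
  \<open>2 * \<tau>\<close>.\<close>

lemma krawtchouk_relations:
  fixes e \<mu> \<nu> \<rho> :: 'a
  assumes u: "ordered_basis d u" and a: "lin a" and K: "lin K" and e: "of_nat d = 2 * e"
    and au: "\<And>i. i \<le> d \<Longrightarrow> a (u i) = (\<mu> * (of_nat i - e)) *s u i + (if i = d then 0 else u (i + 1))"
    and Ku: "\<And>i. i \<le> d \<Longrightarrow> K (u i) = (\<nu> * (of_nat i - e)) *s u i +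
      (if i = 0 then 0 else (of_nat i * (of_nat d - of_nat i + 1) * \<rho>) *s u (i - 1))"
  shows "K (K (a x)) - 2 *s K (a (K x)) + a (K (K x)) = \<nu>\<^sup>2 *s a x - (2 * \<rho> + \<mu> * \<nu>) *s K x"
    and "a (a (K x)) - 2 *s a (K (a x)) + K (a (a x)) = \<mu>\<^sup>2 *s K x - (2 * \<rho> + \<mu> * \<nu>) *s a x"
proof -
  \<comment> \<open>Extension by 0 removes the case split at \<open>d\<close> from the action of
    \<open>a\<close>; for \<open>K\<close> the boundary is covered by the factor
    \<open>2 * e - of_nat i\<close>, which is zero at \<open>i = d\<close>.\<close>
  define u' where "u' i = (if i \<le> d then u i else 0)" for i
  note lins = lin_add[OF a] lin_add[OF K] lin_diff[OF a] lin_diff[OF K] lin_scale[OF a] lin_scale[OF K]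
    lin_zero[OF a] lin_zero[OF K]
  note coords = coord_add[OF u] coord_diff[OF u] coord_scale[OF u] coord_zero[OF u]
  have neg: "a (- x) = - a x" "K (- x) = - K x" "coord d u (- x) j = - coord d u x j" for x j
    using lin_diff[OF a, of 0 x] lin_diff[OF K, of 0 x] coord_diff[OF u, of 0 x j] by (simp_all add: lins coords)
  have au': "a (u' i) = (\<mu> * (of_nat i - e)) *s u' i + u' (Suc i)" for i
    using au[of i] by (auto simp: u'_def lins)
  have K0: "K (u' 0) = (- \<nu> * e) *s u' 0"
    using Ku[of 0] by (simp add: u'_def)
  have KS: "K (u' (Suc i)) = (\<nu> * (of_nat i + 1 - e)) *s u' (Suc i) +
      ((of_nat i + 1) * (2 * e - of_nat i) * \<rho>) *s u' i" for i
  proof -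
    consider "Suc i \<le> d" | "i = d" | "d < i" by linarith
    then show ?thesis
    proof cases
      case 1
      then show ?thesis using Ku[of "Suc i"] by (simp add: u'_def e algebra_simps)
    qed (simp_all add: u'_def lins e)
  qed
  have u_eq: "u i = u' i" if "i \<le> d" for i using that by (simp add: u'_def)
  have lin1: "lin (\<lambda>x. K (K (a x)) - 2 *s K (a (K x)) + a (K (K x)))"
    and lin2: "lin (\<lambda>x. a (a (K x)) - 2 *s a (K (a x)) + K (a (a x)))"
    and lin3: "lin (\<lambda>x. \<nu>\<^sup>2 *s a x - (2 * \<rho> + \<mu> * \<nu>) *s K x)"
    and lin4: "lin (\<lambda>x. \<mu>\<^sup>2 *s K x - (2 * \<rho> + \<mu> * \<nu>) *s a x)"
    by (simp_all add: lin_iff lins algebra_simps)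
  show "K (K (a x)) - 2 *s K (a (K x)) + a (K (K x)) = \<nu>\<^sup>2 *s a x - (2 * \<rho> + \<mu> * \<nu>) *s K x"
  proof (rule lin_eqI[OF u lin1 lin3], unfold u_eq, rule coord_eqI[OF u])
    fix i j
    \<comment> \<open>\<open>K\<close> may lower the index twice, so the two smallest indices are
      treated separately.\<close>
    consider "i = 0" | "i = Suc 0" | p where "i = Suc (Suc p)" by (metis nat.exhaust)
    then show "coord d u (K (K (a (u' i))) - 2 *s K (a (K (u' i))) + a (K (K (u' i)))) j =
      coord d u (\<nu>\<^sup>2 *s a (u' i) - (2 * \<rho> + \<mu> * \<nu>) *s K (u' i)) j"
      by cases (simp_all add: au' K0 KS lins coords neg, simp_all add: algebra_simps power2_eq_square)
  qed
  show "a (a (K x)) - 2 *s a (K (a x)) + K (a (a x)) = \<mu>\<^sup>2 *s K x - (2 * \<rho> + \<mu> * \<nu>) *s a x"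
  proof (rule lin_eqI[OF u lin2 lin4], unfold u_eq, rule coord_eqI[OF u])
    fix i j
    consider "i = 0" | p where "i = Suc p" by (metis nat.exhaust)
    then show "coord d u (a (a (K (u' i))) - 2 *s a (K (a (u' i))) + K (a (a (u' i)))) j =
      coord d u (\<mu>\<^sup>2 *s K (u' i) - (2 * \<rho> + \<mu> * \<nu>) *s a (u' i)) j"
      by cases (simp_all add: au' K0 KS lins coords neg, simp_all add: algebra_simps power2_eq_square)
  qed
qed

text \<open>The relation contains only the square of \<open>n\<close>, so
  \<open>krawtchouk_split\<close> applies to \<open>n\<close> and to \<open>- n\<close> and gives
  split bases for both orders of the eigenvalues of \<open>B\<close>. One controls the entries of
  \<open>As\<close> above the diagonal on an eigenbasis of \<open>B\<close>, the other those
  below.\<close>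

lemma krawtchouk_pair:
  fixes e m n c :: 'a
  assumes v: "ordered_basis d v" and B: "lin B" and As: "lin As"
    and d: "3 \<le> d" and e: "of_nat d = 2 * e" and m: "m \<noteq> 0" and n: "n \<noteq> 0"
    and inj: "inj_on (of_nat :: nat \<Rightarrow> 'a) {..d}"
    and s: "\<And>i. i \<le> d \<Longrightarrow> s i = c + m * (of_nat i - e)"
    and Asv: "\<And>i. i \<le> d \<Longrightarrow> As (v i) = s i *s v i"
    and irr: "irreducible_tridiagonal (matrix_of d v B)"
    and zero_diag: "\<And>i. i \<le> d \<Longrightarrow> coord d v (B (v i)) i = 0"
    and K_def: "\<And>x. K x = As x - c *s x"
    and rel: "\<And>x. K (B (B x)) = n\<^sup>2 *s K x - B (B (K x)) + 2 *s B (K (B x))"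
    and t: "\<And>i. i \<le> d \<Longrightarrow> t i = n * (of_nat i - e)"
    and \<phi>1: "\<And>i. 1 \<le> i \<Longrightarrow> i \<le> d \<Longrightarrow> \<phi>1 i = - n * m * of_nat i * (of_nat d - of_nat i + 1) / 2"
    and \<phi>2: "\<And>i. 1 \<le> i \<Longrightarrow> i \<le> d \<Longrightarrow> \<phi>2 i = n * m * of_nat i * (of_nat d - of_nat i + 1) / 2"
  shows "parameter_array d B As t s \<phi>1 \<phi>2" and "krawtchouk_type d B As"
proof -
  have two: "(2 :: 'a) \<noteq> 0"
    using inj_onD[OF inj, of 2 0] d by auto
  have K: "lin K"
    using As by (simp add: lin_iff K_def algebra_simps)
  have Kv: "K (v i) = (m * (of_nat i - e)) *s v i" if "i \<le> d" for i
    using that by (simp add: K_def Asv s scale_left_distrib)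
  have As_K: "As x = K x + c *s x" for x by (simp add: K_def)
  obtain w where w: "ordered_basis d w"
    and "\<And>i. i \<le> d \<Longrightarrow> B (w i) = (n * (of_nat i - e)) *s w i + (if i = d then 0 else w (i + 1))"
    and "\<And>i. i \<le> d \<Longrightarrow> K (w i) = (m * (of_nat i - e)) *s w i +
      (if i = 0 then 0 else (- n * m * of_nat i * (of_nat d - of_nat i + 1) / 2) *s w (i - 1))"
    using krawtchouk_split[OF v B K _ e m inj Kv irr zero_diag rel] d by auto
  then have Bw: "B (w i) = t i *s w i + (if i = d then 0 else w (i + 1))"
    and Asw: "As (w i) = s i *s w i + (if i = 0 then 0 else \<phi>1 i *s w (i - 1))" if "i \<le> d" for i
    using that by (simp_all add: As_K t s \<phi>1 scale_left_distrib)
  have rel': "K (B (B x)) = (- n)\<^sup>2 *s K x - B (B (K x)) + 2 *s B (K (B x))" for x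
    using rel by simp
  obtain w' where w': "ordered_basis d w'"
    and "\<And>i. i \<le> d \<Longrightarrow> B (w' i) = (- n * (of_nat i - e)) *s w' i + (if i = d then 0 else w' (i + 1))"
    and "\<And>i. i \<le> d \<Longrightarrow> K (w' i) = (m * (of_nat i - e)) *s w' i +
      (if i = 0 then 0 else (- (- n) * m * of_nat i * (of_nat d - of_nat i + 1) / 2) *s w' (i - 1))"
    using krawtchouk_split[OF v B K _ e m inj Kv irr zero_diag rel'] d by auto
  moreover have t_rev: "t (d - i) = - n * (of_nat i - e)" if "i \<le> d" for i
    using that t[of "d - i"] by (simp add: of_nat_diff e algebra_simps)
  ultimately have Bw': "B (w' i) = t (d - i) *s w' i + (if i = d then 0 else w' (i + 1))"
    and Asw': "As (w' i) = s i *s w' i + (if i = 0 then 0 else \<phi>2 i *s w' (i - 1))" if "i \<le> d" for i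
    using that by (simp_all add: As_K s \<phi>2 scale_left_distrib)
  have inj_t: "inj_on t {..d}"
    using inj n by (auto simp: inj_on_def t)
  have inj_t': "inj_on (\<lambda>i. t (d - i)) {..d}"
    using inj n by (auto simp: inj_on_def t_rev)
  have inj_s: "inj_on s {..d}"
    using inj m by (auto simp: inj_on_def s)
  \<comment> \<open>Both factors come from numbers in \<open>1..d\<close>, where
    \<open>of_nat\<close> is nonzero.\<close>
  have nz: "of_nat i * (of_nat d - of_nat i + 1) \<noteq> (0 :: 'a)" if "1 \<le> i" "i \<le> d" for i
  proof -
    have "of_nat d - of_nat i + 1 = (of_nat (d - i + 1) :: 'a)" using that by (simp add: of_nat_diff)
    moreover have "of_nat i \<noteq> (0 :: 'a)"
      using inj_onD[OF inj, of i 0] that by auto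
    moreover have "d - i + 1 \<in> {..d}" using that by auto
    then have "of_nat (d - i + 1) \<noteq> (0 :: 'a)"
      using inj_onD[OF inj, of "d - i + 1" 0] by auto
    ultimately show ?thesis by (simp only: mult_eq_0_iff) blast
  qed
  have \<phi>1_nz: "\<phi>1 i \<noteq> 0" and \<phi>2_nz: "\<phi>2 i \<noteq> 0" if "1 \<le> i" "i \<le> d" for i
  proof -
    have "\<phi>1 i = (- n * m / 2) * (of_nat i * (of_nat d - of_nat i + 1))"
      "\<phi>2 i = (n * m / 2) * (of_nat i * (of_nat d - of_nat i + 1))"
      using \<phi>1[OF that] \<phi>2[OF that] by simp_all
    moreover have "- n * m / 2 \<noteq> 0" "n * m / 2 \<noteq> 0" using n m two by simp_all
    ultimately show "\<phi>1 i \<noteq> 0" "\<phi>2 i \<noteq> 0"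
      using nz[OF that] by (metis no_zero_divisors)+
  qed
  obtain z where z: "ordered_basis d z" and Bz: "\<And>i. i \<le> d \<Longrightarrow> B (z i) = t i *s z i"
    using lower_bidiagonal_eigenbasis[OF w B Bw inj_t] by blast
  have up: "i \<le> d \<Longrightarrow> j + 1 < i \<Longrightarrow> coord d z (As (z i)) j = 0"
    "i < d \<Longrightarrow> coord d z (As (z (i + 1))) i \<noteq> 0" for i j
    using split_eigenbasis_coord[OF w B As Bw Asw inj_t \<phi>1_nz z Bz] by blast+
  \<comment> \<open>The reversed eigenbasis belongs to the ordering \<open>t (d - i)\<close>;
    entries above its diagonal are entries below the diagonal for \<open>z\<close>.\<close>
  have "i \<le> d \<Longrightarrow> j + 1 < i \<Longrightarrow> coord d (\<lambda>i. z (d - i)) (As (z (d - i))) j = 0"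
    "i < d \<Longrightarrow> coord d (\<lambda>i. z (d - i)) (As (z (d - (i + 1)))) i \<noteq> 0" for i j
    using split_eigenbasis_coord[OF w' B As Bw' Asw' inj_t' \<phi>2_nz ordered_basis_rev[OF z]] Bz
    by simp_all
  note down = this[unfolded coord_rev]
  have irr_z: "irreducible_tridiagonal (matrix_of d z As)"
    unfolding irreducible_tridiagonal_matrix_of
  proof (intro allI impI conjI)
    fix i j assume i: "i \<le> d" and j: "j \<le> d"
    show "coord d z (As (z j)) i = 0" if "i + 1 < j \<or> j + 1 < i"
      using that up(1)[of j i] down(1)[of "d - j" "d - i"] i j by auto
    show "coord d z (As (z j)) i \<noteq> 0" if "j = i + 1 \<or> i = j + 1"
    proof (cases "j = i + 1")
      case True
      then show ?thesis using up(2)[of i] j by simp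
    next
      case False
      then have "i = j + 1" using that by simp
      moreover from this have "d - (d - i + 1) = j" "d - i < d" using i by auto
      ultimately show ?thesis using down(2)[of "d - i"] i by simp
    qed
  qed
  have mat_z: "matrix_of d z B = mat_diag (d + 1) t"
    using Bz by (simp only: matrix_of_diag[OF z]) blast
  have mat_v: "matrix_of d v As = mat_diag (d + 1) s"
    using Asv by (simp only: matrix_of_diag[OF v]) blast
  have std: "standard_ordering d B As t"
    unfolding standard_ordering_def
    using z mat_z irr_z inj_t eigenvalues_diag[OF z B Bz] by (auto simp: bij_betw_def)
  have std_s: "standard_ordering d As B s"
    unfolding standard_ordering_def
    using v mat_v irr inj_s eigenvalues_diag[OF v As Asv] by (auto simp: bij_betw_def)
  have "diagonal_mat (mat_diag (d + 1) f)" for f :: "nat \<Rightarrow> 'a"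
    by (simp add: diagonal_mat_def mat_diag_def)
  then have pair: "leonard_pair d B As"
    unfolding leonard_pair_def
    using dim_ordered_basis[OF v] B As v irr mat_v z irr_z mat_z by metis
  show "parameter_array d B As t s \<phi>1 \<phi>2"
  proof -
    have "matrix_of d w B = lower_bidiagonal d t" "matrix_of d w As = upper_bidiagonal d s \<phi>1"
      using Bw Asw by (simp_all only: matrix_of_lower_bidiagonal[OF w] matrix_of_upper_bidiagonal[OF w]) blast+
    moreover have "matrix_of d w' B = lower_bidiagonal d (\<lambda>i. t (d - i))"
      "matrix_of d w' As = upper_bidiagonal d s \<phi>2"
      using Bw' Asw' by (simp_all only: matrix_of_lower_bidiagonal[OF w'] matrix_of_upper_bidiagonal[OF w']) blast+
    ultimately show ?thesis
      unfolding parameter_array_def using pair std std_s w w' by blast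
  qed
  have "(t (i - 2) - t (i + 1)) / (t (i - 1) - t i) = 2 + 1 \<and>
      (s (i - 2) - s (i + 1)) / (s (i - 1) - s i) = 2 + 1" if i: "i \<in> {2..d - 1}" for i
  proof -
    obtain p where "i = p + 2" using i by (metis atLeastAtMost_iff le_add_diff_inverse2)
    then show ?thesis using i d m n by (simp add: t s field_simps)
  qed
  then have "type_II d B As"
    unfolding type_II_def has_beta_def using d pair std std_s by blast
  moreover have "t i - t (i - 1) = n" "s i - s (i - 1) = m" if "i \<in> {1..d}" for i
    using that by (cases i; simp add: t s algebra_simps)+
  ultimately show "krawtchouk_type d B As"
    unfolding krawtchouk_type_def using std std_s by blast
qed

section \<open>Vanishing quadratic terms and the contraction\<close>

text \<open>\<open>krawtchouk_type\<close> only asserts that some standard ordering is arithmetic;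
  uniqueness up to reversal carries this over to the given one.\<close>

lemma standard_ordering_arithmetic:
  assumes lin: "lin A" "lin As" and ord: "standard_ordering d A As t" "standard_ordering d A As t2"
    and c: "\<forall>i\<in>{1..d}. t2 i - t2 (i - 1) = c" and d: "2 \<le> d"
  shows "t 2 - t 1 = t 1 - t 0"
  using standard_ordering_unique[OF lin ord]
proof
  assume "\<forall>i\<le>d. t2 i = t i"
  then show ?thesis using bspec[OF c, of 1] bspec[OF c, of 2] d by simp
next
  assume *: "\<forall>i\<le>d. t2 i = t (d - i)"
  have "d - (d - 1) = 1" "d - (d - 1 - 1) = 2" "d - 1 \<in> {1..d}" "d \<in> {1..d}" using d by auto
  then have "t 0 - t 1 = c" "t 1 - t 2 = c"
    using bspec[OF c, of d] bspec[OF c, of "d - 1"] * d by auto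
  then show ?thesis by (simp add: algebra_simps)
qed

text \<open>The second difference of \<open>z * i * (d - i)\<close> is \<open>- 2 * z\<close>, and
  the linear part contributes nothing.\<close>

lemma quadratic_coefficient_zero:
  fixes e x y z :: 'a
  assumes "(2 :: 'a) \<noteq> 0" "of_nat d = 2 * e" "2 \<le> d"
    and t: "\<And>i. i \<le> d \<Longrightarrow> t i = x + y * (of_nat i - e) + z * of_nat i * (of_nat d - of_nat i)"
    and "t 2 - t 1 = t 1 - t 0"
  shows "z = 0"
proof -
  have t012: "t 0 = x - y * e" "t 1 = x + y * (1 - e) + z * (2 * e - 1)"
    "t 2 = x + y * (2 - e) + z * 2 * (2 * e - 2)"
    using t[of 0] t[of 1] t[of 2] assms(2,3) by simp_all
  have "2 * z = (t 1 - t 0) - (t 2 - t 1)"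
    unfolding t012 by (simp add: algebra_simps)
  then have "2 * z = 0" using assms(5) by simp
  with assms(1) show ?thesis by simp
qed

text \<open>The map \<open>B\<close> below is identified with the contraction and shown to satisfy
  the hypotheses of \<open>krawtchouk_pair\<close>.\<close>

lemma krawtchouk_contraction:
  fixes \<delta> \<mu> h \<delta>s \<mu>s hs \<tau> n :: 'a
  assumes two: "(2 :: 'a) \<noteq> 0" and d: "3 \<le> d"
    and kraw: "krawtchouk_type d A As"
    and par: "parameter_array d A As \<theta> \<theta>s \<phi>1 \<phi>2"
    and prim: "primary_data d \<theta> \<theta>s \<phi>1 \<phi>2 \<delta> \<mu> h \<delta>s \<mu>s hs \<tau>"
    and n: "n\<^sup>2 = \<mu>\<^sup>2 - 4 * \<tau>\<^sup>2 / \<mu>s\<^sup>2"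
    and \<theta>': "\<And>i. i \<le> d \<Longrightarrow> \<theta>' i = n * (of_nat i - of_nat d / 2)"
    and \<phi>1': "\<And>i. 1 \<le> i \<Longrightarrow> i \<le> d \<Longrightarrow> \<phi>1' i = - n * \<mu>s * of_nat i * (of_nat d - of_nat i + 1) / 2"
    and \<phi>2': "\<And>i. 1 \<le> i \<Longrightarrow> i \<le> d \<Longrightarrow> \<phi>2' i = n * \<mu>s * of_nat i * (of_nat d - of_nat i + 1) / 2"
  shows "parameter_array d (contraction A As) As \<theta>' \<theta>s \<phi>1' \<phi>2'"
    and "krawtchouk_type d (contraction A As) As"
proof -
  define e :: 'a where "e = of_nat d / 2"
  have e: "of_nat d = 2 * e" using two by (simp add: e_def)
  have A: "lin A" and As: "lin As"
    using par by (auto simp: parameter_array_def leonard_pair_def)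
  have std: "standard_ordering d A As \<theta>" "standard_ordering d As A \<theta>s"
    using par by (auto simp: parameter_array_def)
  obtain v where v: "ordered_basis d v" and Asv: "\<And>i. i \<le> d \<Longrightarrow> As (v i) = \<theta>s i *s v i"
    and irr: "irreducible_tridiagonal (matrix_of d v A)"
    using std(2) unfolding standard_ordering_def by (metis matrix_of_diag)
  obtain u where u: "ordered_basis d u" and u_mat: "matrix_of d u A = lower_bidiagonal d \<theta>"
      "matrix_of d u As = upper_bidiagonal d \<theta>s \<phi>1"
    using par unfolding parameter_array_def by blast
  have Au: "A (u i) = \<theta> i *s u i + (if i = d then 0 else u (i + 1))"
    and Asu: "As (u i) = \<theta>s i *s u i + (if i = 0 then 0 else \<phi>1 i *s u (i - 1))" if "i \<le> d" for i
    using u_mat that unfolding matrix_of_lower_bidiagonal[OF u] matrix_of_upper_bidiagonal[OF u]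
    by blast+
  obtain u' where u': "ordered_basis d u'"
    and u'_mat: "matrix_of d u' A = lower_bidiagonal d (\<lambda>i. \<theta> (d - i))"
      "matrix_of d u' As = upper_bidiagonal d \<theta>s \<phi>2"
    using par unfolding parameter_array_def by blast
  have Au': "A (u' i) = \<theta> (d - i) *s u' i + (if i = d then 0 else u' (i + 1))"
    and Asu': "As (u' i) = \<theta>s i *s u' i + (if i = 0 then 0 else \<phi>2 i *s u' (i - 1))" if "i \<le> d" for i
    using u'_mat that unfolding matrix_of_lower_bidiagonal[OF u'] matrix_of_upper_bidiagonal[OF u']
    by blast+
  have \<theta>_quad: "\<theta> i = \<delta> + \<mu> * (of_nat i - e) + h * of_nat i * (of_nat d - of_nat i)"
    and \<theta>s_quad: "\<theta>s i = \<delta>s + \<mu>s * (of_nat i - e) + hs * of_nat i * (of_nat d - of_nat i)"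
    if "i \<le> d" for i
    using prim that by (simp_all add: primary_data_def e_def)
  obtain t ts c cs where t: "standard_ordering d A As t" "standard_ordering d As A ts"
    and c: "\<forall>i\<in>{1..d}. t i - t (i - 1) = c" "\<forall>i\<in>{1..d}. ts i - ts (i - 1) = cs"
    using kraw unfolding krawtchouk_type_def by blast
  have "2 \<le> d" using d by simp
  have h: "h = 0" and hs: "hs = 0"
    using quadratic_coefficient_zero[OF two e \<open>2 \<le> d\<close> \<theta>_quad
        standard_ordering_arithmetic[OF A As std(1) t(1) c(1) \<open>2 \<le> d\<close>]]
      quadratic_coefficient_zero[OF two e \<open>2 \<le> d\<close> \<theta>s_quad
        standard_ordering_arithmetic[OF As A std(2) t(2) c(2) \<open>2 \<le> d\<close>]] by simp_all
  have \<theta>: "\<theta> i = \<delta> + \<mu> * (of_nat i - e)" and \<theta>s: "\<theta>s i = \<delta>s + \<mu>s * (of_nat i - e)" if "i \<le> d" for i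
    using \<theta>_quad[OF that] \<theta>s_quad[OF that] by (simp_all add: h hs)
  have inj_\<theta>s: "inj_on \<theta>s {..d}"
    using std(2) by (auto simp: standard_ordering_def bij_betw_def)
  have \<mu>s: "\<mu>s \<noteq> 0"
    using inj_onD[OF inj_\<theta>s, of 0 1] d by (auto simp: \<theta>s)
  \<comment> \<open>Distinctness of the arithmetic sequence \<open>\<theta>s\<close> forces this; a
    positive characteristic must therefore exceed \<open>d\<close>.\<close>
  have inj: "inj_on (of_nat :: nat \<Rightarrow> 'a) {..d}"
  proof (rule inj_onI)
    fix i j assume "i \<in> {..d}" "j \<in> {..d}" "of_nat i = (of_nat j :: 'a)"
    then show "i = j" using inj_onD[OF inj_\<theta>s, of i j] by (auto simp: \<theta>s)
  qed
  define \<rho> where "\<rho> = \<tau> - \<mu> * \<mu>s / 2"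
  \<comment> \<open>Chosen such that the first commutator relation reads
    \<open>[K, [K, a]] = \<mu>s\<^sup>2 (a - \<kappa> K)\<close>.\<close>
  define \<kappa> where "\<kappa> = 2 * \<tau> / \<mu>s\<^sup>2"
  have \<phi>1: "\<phi>1 i = of_nat i * (of_nat d - of_nat i + 1) * \<rho>"
    and \<phi>2: "\<phi>2 i = of_nat i * (of_nat d - of_nat i + 1) * (\<tau> + \<mu> * \<mu>s / 2)" if "1 \<le> i" "i \<le> d" for i
    using prim that by (simp_all add: primary_data_def \<rho>_def h hs)
  define a where "a x = A x - \<delta> *s x" for x
  define K where "K x = As x - \<delta>s *s x" for x
  define B where "B x = a x - \<kappa> *s K x" for x
  have a: "lin a" and K: "lin K"
    using A As by (simp_all add: lin_iff a_def K_def algebra_simps)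
  then have B: "lin B" by (simp add: lin_iff B_def algebra_simps)
  note lins = lin_add[OF a] lin_add[OF K] lin_diff[OF a] lin_diff[OF K] lin_scale[OF a] lin_scale[OF K]
  have au: "a (u i) = (\<mu> * (of_nat i - e)) *s u i + (if i = d then 0 else u (i + 1))"
    and Ku: "K (u i) = (\<mu>s * (of_nat i - e)) *s u i +
      (if i = 0 then 0 else (of_nat i * (of_nat d - of_nat i + 1) * \<rho>) *s u (i - 1))" if "i \<le> d" for i
    using that by (simp_all add: a_def K_def Au Asu \<theta> \<theta>s \<phi>1 scale_left_distrib)
  have \<tau>: "2 * \<rho> + \<mu> * \<mu>s = \<kappa> * \<mu>s\<^sup>2"
    using two \<mu>s by (simp add: \<rho>_def \<kappa>_def field_simps)
  note rel = krawtchouk_relations[OF u a K e au Ku, unfolded \<tau>]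
  have n_\<kappa>: "n\<^sup>2 = \<mu>\<^sup>2 - \<kappa>\<^sup>2 * \<mu>s\<^sup>2"
  proof -
    have "\<kappa>\<^sup>2 * \<mu>s\<^sup>2 = 4 * \<tau>\<^sup>2 / \<mu>s\<^sup>2"
      using \<mu>s by (simp add: \<kappa>_def field_simps power2_eq_square)
    then show ?thesis by (simp add: n)
  qed
  \<comment> \<open>Since \<open>[B, K] = [a, K]\<close>, the double commutator
    \<open>[B, [B, K]]\<close> is \<open>[a, [a, K]] + \<kappa> [K, [K, a]]\<close>; the terms in
    \<open>a\<close> cancel.\<close>
  have BK: "K (B (B x)) = n\<^sup>2 *s K x - B (B (K x)) + 2 *s B (K (B x))" for x
  proof (rule coord_eqI[OF v])
    fix j
    note coords = coord_add[OF v] coord_diff[OF v] coord_scale[OF v]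
    have 1: "coord d v (K (K (a x)) - 2 *s K (a (K x)) + a (K (K x))) j =
        coord d v (\<mu>s\<^sup>2 *s a x - (\<kappa> * \<mu>s\<^sup>2) *s K x) j"
      by (simp only: rel(1))
    have 2: "coord d v (a (a (K x)) - 2 *s a (K (a x)) + K (a (a x))) j =
        coord d v (\<mu>\<^sup>2 *s K x - (\<kappa> * \<mu>s\<^sup>2) *s a x) j"
      by (simp only: rel(2))
    have "coord d v (K (B (B x))) j - coord d v (n\<^sup>2 *s K x - B (B (K x)) + 2 *s B (K (B x))) j =
      (coord d v (a (a (K x)) - 2 *s a (K (a x)) + K (a (a x))) j
        - coord d v (\<mu>\<^sup>2 *s K x - (\<kappa> * \<mu>s\<^sup>2) *s a x) j)
      + \<kappa> * (coord d v (K (K (a x)) - 2 *s K (a (K x)) + a (K (K x))) j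
        - coord d v (\<mu>s\<^sup>2 *s a x - (\<kappa> * \<mu>s\<^sup>2) *s K x) j)"
      unfolding B_def n_\<kappa> lins coords by (simp add: algebra_simps power2_eq_square)
    then show "coord d v (K (B (B x))) j = coord d v (n\<^sup>2 *s K x - B (B (K x)) + 2 *s B (K (B x))) j"
      unfolding 1 2 by simp
  qed
  have Kv: "K (v i) = (\<mu>s * (of_nat i - e)) *s v i" if "i \<le> d" for i
    using that by (simp add: K_def Asv \<theta>s scale_left_distrib)
  have B_A: "B x = A x - \<delta> *s x - \<kappa> *s K x" for x by (simp add: B_def a_def)
  \<comment> \<open>On an eigenbasis of \<open>K\<close> the diagonal of \<open>[K, [K, a]]\<close>
    is 0, while the relation equates this map with \<open>\<mu>s\<^sup>2 B\<close>.\<close>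
  have zero_diag: "coord d v (B (v i)) i = 0" if i: "i \<le> d" for i
  proof -
    let ?k = "\<mu>s * (of_nat i - e)"
    note Kc = coord_diag[OF v K Kv i]
    have "coord d v (K (K (a (v i))) - 2 *s K (a (K (v i))) + a (K (K (v i)))) i = 0"
      using i by (simp add: coord_add[OF v] coord_diff[OF v] coord_scale[OF v] Kc Kv lins algebra_simps)
    then have "coord d v (\<mu>s\<^sup>2 *s a (v i) - (\<kappa> * \<mu>s\<^sup>2) *s K (v i)) i = 0"
      by (simp only: rel(1))
    moreover have "\<mu>s\<^sup>2 *s a (v i) - (\<kappa> * \<mu>s\<^sup>2) *s K (v i) = \<mu>s\<^sup>2 *s B (v i)"
      by (simp add: B_def algebra_simps)
    ultimately have "\<mu>s\<^sup>2 * coord d v (B (v i)) i = 0"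
      by (simp only: coord_scale[OF v])
    then show ?thesis using \<mu>s by simp
  qed
  have "contraction A As = B"
  proof
    fix x
    \<comment> \<open>The flat part is the diagonal of \<open>A\<close> on \<open>v\<close>, and
      \<open>B = A - \<delta> - \<kappa> K\<close> has zero diagonal there.\<close>
    have "flat_part A As x = \<delta> *s x + \<kappa> *s K x"
    proof (rule coord_eqI[OF v])
      fix i assume i: "i \<le> d"
      have "flat_part A As x = (\<Sum>i\<le>d. (coord d v x i * coord d v (A (v i)) i) *s v i)"
        by (rule flat_part_diag[OF v As Asv inj_\<theta>s A])
      then have "coord d v (flat_part A As x) i = coord d v x i * coord d v (A (v i)) i"
        using coord_of_sum[OF v i, of "\<lambda>i. coord d v x i * coord d v (A (v i)) i"] by simp
      moreover
      have "coord d v (A (v i)) i = \<delta> + \<kappa> * (\<mu>s * (of_nat i - e))"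
        using zero_diag[OF i] i
        by (simp add: B_A Kv coord_diff[OF v] coord_scale[OF v] coord_basis[OF v])
          (simp add: algebra_simps)
      ultimately show "coord d v (flat_part A As x) i = coord d v (\<delta> *s x + \<kappa> *s K x) i"
        using i by (simp add: coord_add[OF v] coord_scale[OF v] coord_diag[OF v K Kv] algebra_simps)
    qed
    then show "contraction A As x = B x" by (simp add: contraction_def B_A)
  qed
  moreover have irr_B: "irreducible_tridiagonal (matrix_of d v B)"
  proof -
    have "coord d v (B (v j)) i = coord d v (A (v j)) i" if "i \<le> d" "j \<le> d" "i \<noteq> j" for i j
      using that by (simp add: B_A Kv coord_diff[OF v] coord_scale[OF v] coord_basis[OF v])
    then show ?thesis
      using irr unfolding irreducible_tridiagonal_matrix_of
      by (metis add.commute less_add_one less_irrefl not_add_less2 trans_less_add1)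
  qed
  \<comment> \<open>Up to a nonzero factor, \<open>n\<^sup>2\<close> is the product of the scalars
    in \<open>\<phi>1 d\<close> and \<open>\<phi>2 d\<close>. If \<open>\<phi>1 d\<close> or
    \<open>\<phi>2 d\<close> vanished, the last vector of its split basis would be a common
    eigenvector.\<close>
  moreover have "n \<noteq> 0"
  proof
    have common: "x = 0" if "A x = p *s x" "As x = q *s x" for x p q
      using no_common_eigenvector[OF v A As Asv inj_\<theta>s irr _ that] d by simp
    have "\<phi>1 d \<noteq> 0"
    proof
      assume "\<phi>1 d = 0"
      then have "u d = 0" using Au[of d] Asu[of d] d by (intro common[of _ "\<theta> d" "\<theta>s d"]) auto
      then show False using ordered_basis_nonzero[OF u, of d] by simp
    qed
    moreover have "\<phi>2 d \<noteq> 0"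
    proof
      assume "\<phi>2 d = 0"
      then have "u' d = 0" using Au'[of d] Asu'[of d] d by (intro common[of _ "\<theta> 0" "\<theta>s d"]) auto
      then show False using ordered_basis_nonzero[OF u', of d] by simp
    qed
    ultimately have nz: "\<tau> - \<mu> * \<mu>s / 2 \<noteq> 0" "\<tau> + \<mu> * \<mu>s / 2 \<noteq> 0"
      using \<phi>1[of d] \<phi>2[of d] d by (auto simp: \<rho>_def)
    assume "n = 0"
    then have "(\<tau> - \<mu> * \<mu>s / 2) * (\<tau> + \<mu> * \<mu>s / 2) = 0"
      using n two \<mu>s by (simp add: field_simps power2_eq_square)
    with nz show False by simp
  qed
  moreover note krawtchouk_pair[OF v B As d e \<mu>s _ inj \<theta>s Asv irr_B zero_diag K_def BK
      \<theta>'[folded e_def] \<phi>1' \<phi>2']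
  ultimately show "parameter_array d (contraction A As) As \<theta>' \<theta>s \<phi>1' \<phi>2'"
    and "krawtchouk_type d (contraction A As) As"
    by simp_all
qed

end

theorem proposition24p5:
  fixes scale :: "'f::alg_closed_field \<Rightarrow> 'v::ab_group_add \<Rightarrow> 'v"
    and A As :: "'v \<Rightarrow> 'v"
    and d :: nat
    and \<theta> \<theta>s \<phi>1 \<phi>2 \<theta>' \<phi>1' \<phi>2' :: "nat \<Rightarrow> 'f"
    and \<delta> \<mu> h \<delta>s \<mu>s hs \<tau> \<mu>' :: 'f
  assumes "CHAR('f) \<noteq> 2"
    and "d \<ge> 3"
    and "vector_space scale"
    and "leonard_space.leonard_pair scale d A As"
    and "leonard_space.krawtchouk_type scale d A As"
    and "leonard_space.parameter_array scale d A As \<theta> \<theta>s \<phi>1 \<phi>2"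
    and "primary_data d \<theta> \<theta>s \<phi>1 \<phi>2 \<delta> \<mu> h \<delta>s \<mu>s hs \<tau>"
    and "\<mu>'\<^sup>2 = \<mu>\<^sup>2 - 4 * \<tau>\<^sup>2 / \<mu>s\<^sup>2"
    and "\<forall>i\<le>d. \<theta>' i = \<mu>' * (of_nat i - of_nat d / 2)"
    and "\<forall>i\<in>{1..d}. \<phi>1' i = - \<mu>' * \<mu>s * of_nat i * (of_nat d - of_nat i + 1) / 2"
    and "\<forall>i\<in>{1..d}. \<phi>2' i = \<mu>' * \<mu>s * of_nat i * (of_nat d - of_nat i + 1) / 2"
  shows "leonard_space.near_bipartite scale d A As \<and>
    leonard_space.krawtchouk_type scale d (leonard_space.contraction scale A As) As \<and>
    leonard_space.parameter_array scale d (leonard_space.contraction scale A As) As \<theta>' \<theta>s \<phi>1' \<phi>2'"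
proof -
  interpret leonard_space scale
    using assms(3) by (simp add: leonard_space_def)
  have two: "(2 :: 'f) \<noteq> 0"
  proof
    assume "(2 :: 'f) = 0"
    then have "of_nat 2 = (0 :: 'f)" by simp
    \<comment> \<open>The characteristic of a field is not 1, so as a divisor of 2 it would have to
      be 2.\<close>
    then have dvd: "CHAR('f) dvd 2" by (simp only: of_nat_eq_0_iff_char_dvd)
    then have "CHAR('f) \<le> 2" by (rule dvd_imp_le) simp
    moreover have "CHAR('f) \<noteq> 0" using dvd by (intro notI) simp
    ultimately have "CHAR('f) = 1" using assms(1) by linarith
    then show False by (simp add: CHAR_not_1')
  qed
  have "parameter_array d (contraction A As) As \<theta>' \<theta>s \<phi>1' \<phi>2'"
    and "krawtchouk_type d (contraction A As) As"
    using krawtchouk_contraction[OF two assms(2,5,6,7,8), of \<theta>' \<phi>1' \<phi>2'] assms(9-11) by simp_all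
  then show ?thesis
    using assms(4) by (simp add: near_bipartite_def parameter_array_def)
qed

end
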